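(* Let $G$ be a finite group and $F$ a field of characteristic $0$ or of characteristic prime to the order of $G$. Let $x\in G$ be an element of order $n$, and let $r_1=1,r_2,\dots,r_s$ be the sequence of natural numbers associated with the cyclotomic polynomial $\Phi_n(X)$ over $F$. Then the $F$-conjugacy class of $x$ is $$C_F(x)=C(x^{r_1})\cup C(x^{r_2})\cup\cdots\cup C(x^{r_s}),$$ where $C(g)$ denotes the conjugacy class of $g$ in $G$.
   Context: Two elements $x,y\in G$ are $F$-conjugate if $\chi(x)=\chi(y)$ for the character $\chi$ (trace function, values in $F$) of every finite-dimensional $F$-representation of $G$; $C_F(x)$ is the set of elements $F$-conjugate to $x$. For $n$ with the characteristic of $F$ equal to $0$ or prime to $n$, the sequence associated with $\Phi_n(X)$ over $F$ is a sequence of natural numbers $r_1=1,r_2,\dots,r_s$ such that for every root $\zeta$ of $\Phi_n(X)$ in an algebraic closure of $F$, the roots of the monic irreducible factor of $\Phi_n(X)$ over $F$ having $\zeta$ as a root are exactly the $s$ distinct elements $\zeta^{r_1},\zeta^{r_2},\dots,\zeta^{r_s}$; such a sequence exists, is independent of the factor and of the root, and is unique modulo $n$ up to order (the residues $r_i \bmod n$ form the image of $\mathrm{Gal}(F(\zeta)/F)$ in $(\mathbb{Z}/n)^*$). *)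

theory Defs
  imports
    "HOL-Algebra.Multiplicative_Group"
    "HOL-Algebra.Algebraic_Closure_Type"
    "HOL-Computational_Algebra.Computational_Algebra"
    "Jordan_Normal_Form.Matrix"
begin

text \<open>
  A finite-dimensional representation over the field type \<open>'f\<close> is given in matrix form, as a
  homomorphism into the group of units of the ring of \<open>d\<close>-by-\<open>d\<close> matrices.
\<close>

definition is_representation ::
    "('g, 'm) monoid_scheme \<Rightarrow> nat \<Rightarrow> ('g \<Rightarrow> 'f::field mat) \<Rightarrow> bool" where
  "is_representation G d \<rho> \<longleftrightarrow> \<rho> \<in> hom G (units_of (ring_mat TYPE('f) d ()))"

definition mat_trace :: "'a::comm_monoid_add mat \<Rightarrow> 'a" where
  "mat_trace A = (\<Sum>i<dim_row A. A $$ (i, i))"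

definition rep_character :: "('g \<Rightarrow> 'f::field mat) \<Rightarrow> 'g \<Rightarrow> 'f" where
  "rep_character \<rho> g = mat_trace (\<rho> g)"

definition field_conjugate ::
    "'f::field itself \<Rightarrow> ('g, 'm) monoid_scheme \<Rightarrow> 'g \<Rightarrow> 'g \<Rightarrow> bool" where
  "field_conjugate F G x y \<longleftrightarrow>
     (\<forall>d (\<rho> :: 'g \<Rightarrow> 'f mat). is_representation G d \<rho> \<longrightarrow> rep_character \<rho> x = rep_character \<rho> y)"

definition field_conjugacy_class ::
    "'f::field itself \<Rightarrow> ('g, 'm) monoid_scheme \<Rightarrow> 'g \<Rightarrow> 'g set" where
  "field_conjugacy_class F G x = {y \<in> carrier G. field_conjugate F G x y}"

definition conjugacy_class :: "('g, 'm) monoid_scheme \<Rightarrow> 'g \<Rightarrow> 'g set" where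
  "conjugacy_class G g = {h \<otimes>\<^bsub>G\<^esub> g \<otimes>\<^bsub>G\<^esub> inv\<^bsub>G\<^esub> h | h. h \<in> carrier G}"

text \<open>
  The integral cyclotomic polynomial, from \<open>X^n - 1 = (\<Prod>d | d dvd n. \<Phi>\<^sub>d)\<close>; for \<open>n > 0\<close> the
  divisor is monic and the division is exact.  The value at \<open>n = 0\<close> is irrelevant.
\<close>

fun cyclotomic_poly :: "nat \<Rightarrow> int poly" where
  "cyclotomic_poly n =
     (monom 1 n - 1) div (\<Prod>d\<in>{d. d dvd n \<and> d < n}. cyclotomic_poly d)"

declare cyclotomic_poly.simps [simp del]

text \<open>
  The list \<open>rs\<close> is a sequence associated with the \<open>n\<close>-th cyclotomic polynomial over \<open>'f\<close>:
  its first term is \<open>1\<close>, and for each root \<open>\<zeta>\<close> of that polynomial in the algebraic closure and the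
  monic irreducible factor \<open>p\<close> over \<open>'f\<close> having \<open>\<zeta>\<close> as a root, the powers of \<open>\<zeta>\<close> with exponents
  in \<open>rs\<close> are pairwise distinct and are exactly the roots of \<open>p\<close>.
\<close>

definition cyclotomic_sequence :: "'f::field itself \<Rightarrow> nat \<Rightarrow> nat list \<Rightarrow> bool" where
  "cyclotomic_sequence F n rs \<longleftrightarrow>
     rs \<noteq> [] \<and> hd rs = 1 \<and>
     (\<forall>(\<zeta> :: 'f alg_closure) (p :: 'f poly).
        poly (map_poly of_int (cyclotomic_poly n)) \<zeta> = 0 \<longrightarrow>
        lead_coeff p = 1 \<longrightarrow>
        Factorial_Ring.irreducible p \<longrightarrow>
        p dvd map_poly of_int (cyclotomic_poly n) \<longrightarrow>
        poly (map_poly to_ac p) \<zeta> = 0 \<longrightarrow>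
          distinct (map (\<lambda>r. \<zeta> ^ r) rs) \<and>
          {z. poly (map_poly to_ac p) z = 0} = set (map (\<lambda>r. \<zeta> ^ r) rs))"

end

theory Submission
  imports Defs "Jordan_Normal_Form.Char_Poly" "HOL-Number_Theory.Cong"
begin

text \<open>
  Let \<open>\<zeta>\<close> be a primitive \<open>n\<close>-th root of unity.  A polynomial over the ground field that
  vanishes at \<open>\<zeta>\<close> vanishes at its conjugates \<open>\<zeta>\<^sup>r\<close>.  The trace of \<open>\<rho>(x)\<^sup>k\<close> is
  \<open>f(\<zeta>\<^sup>k)\<close> for one polynomial \<open>f\<close> with natural number coefficients (ranks of the spectral
  projections), so \<open>x\<close> and \<open>x\<^sup>r\<close> have the same character values.

  Conversely, for a Galois stable set \<open>B\<close> of residues modulo \<open>n\<close>, the element of the group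
  algebra with coefficient \<open>(\<Sum>b\<in>B. \<zeta>\<^bsup>bk\<^esup>) / n\<close> at \<open>x\<^sup>k\<close> is an idempotent over the ground
  field.  The representation that it generates takes at \<open>g\<close> the sum of these coefficients over all
  conjugates of \<open>g\<close>, up to a constant.  Suitable combinations of these sums count the \<open>h\<close> for
  which \<open>h\<inverse> g h\<close> is one of the powers \<open>x\<^sup>r\<close>.  For \<open>g = x\<close> this count is the order of a
  subgroup, hence nonzero in the field, so it is nonzero for every \<open>g\<close> in the field conjugacy
  class of \<open>x\<close>.
\<close>

section \<open>Cyclotomic polynomials and their roots\<close>

definition primitive_root :: "nat \<Rightarrow> 'a::monoid_mult \<Rightarrow> bool" where
  "primitive_root n z \<longleftrightarrow> z ^ n = 1 \<and> (\<forall>k. z ^ k = 1 \<longrightarrow> n dvd k)"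

text \<open>By Bezout, \<open>z ^ k = 1\<close> forces \<open>z ^ gcd k n = 1\<close>. The divisor
  \<open>gcd k n\<close> of \<open>n\<close> therefore cannot be proper.\<close>

lemma primitive_rootI:
  fixes z :: "'a::field"
  assumes "n > 0" "z ^ n = 1" and proper: "\<And>d. d dvd n \<Longrightarrow> d < n \<Longrightarrow> z ^ d \<noteq> 1"
  shows "primitive_root n z"
  unfolding primitive_root_def
proof (intro conjI allI impI)
  fix k assume k: "z ^ k = 1"
  show "n dvd k"
  proof (cases "k = 0")
    case False
    obtain a b where ab: "k * a = n * b + gcd k n"
      using bezout_nat[OF False, of n] by (auto simp: mult.commute)
    have "(z ^ k) ^ a = (z ^ n) ^ b * z ^ gcd k n"
      by (simp add: ab flip: power_mult power_add)
    then have "z ^ gcd k n = 1"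
      using k assms by simp
    then have "\<not> gcd k n < n"
      using proper[of "gcd k n"] by auto
    moreover have "gcd k n \<le> n"
      using \<open>n > 0\<close> by (simp add: gcd_le2_nat)
    ultimately have "gcd k n = n"
      by simp
    then show ?thesis
      by (metis gcd_dvd1)
  qed simp
qed (use assms in simp)

lemma monic_eq_prod_roots:
  fixes p :: "'a::idom poly"
  assumes "finite Z" "lead_coeff p = 1" "card Z = degree p" "\<And>z. z \<in> Z \<Longrightarrow> poly p z = 0"
  shows "p = (\<Prod>z\<in>Z. [:- z, 1:])"
proof (rule poly_eqI_degree_lead_coeff[where n = "degree p" and A = Z])
  have deg: "degree (\<Prod>z\<in>Z. [:- z, 1:]) = card Z"
    by (subst degree_prod_eq_sum_degree) auto
  then show "degree (\<Prod>z\<in>Z. [:- z, 1:]) \<le> degree p"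
    using assms by simp
  have "lead_coeff (\<Prod>z\<in>Z. [:- z, 1:]) = 1"
    by (simp add: lead_coeff_prod)
  then show "coeff p (degree p) = coeff (\<Prod>z\<in>Z. [:- z, 1:]) (degree p)"
    using assms deg by simp
  show "poly p z = poly (\<Prod>z\<in>Z. [:- z, 1:]) z" if "z \<in> Z" for z
    using that assms by (auto simp: poly_prod)
qed (use assms in auto)

lemma degree_monom_minus_one:
  assumes "n > 0"
  shows "degree (monom 1 n - 1 :: 'a::comm_ring_1 poly) = n"
    and "lead_coeff (monom 1 n - 1 :: 'a poly) = 1"
proof -
  have "degree (- 1 :: 'a poly) < degree (monom 1 n :: 'a poly)"
    using assms by (simp add: degree_monom_eq)
  from degree_add_eq_left[OF this]
  show *: "degree (monom 1 n - 1 :: 'a poly) = n"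
    by (simp add: degree_monom_eq)
  show "lead_coeff (monom 1 n - 1 :: 'a poly) = 1"
    unfolding * using assms by simp
qed

text \<open>Pseudo-division by a monic polynomial is ordinary division over the integers. Its
  remainder is a complex multiple of \<open>g\<close> and is zero or of smaller degree, hence zero.
  Exactness of the division defining \<open>cyclotomic_poly\<close> can thus be checked over the
  complex numbers.\<close>

lemma dvd_monic_int_poly:
  fixes f g :: "int poly"
  assumes "lead_coeff g = 1"
    and dvd: "map_poly of_int g dvd (map_poly of_int f :: complex poly)"
  shows "g dvd f"
proof -
  have g0: "g \<noteq> 0"
    using assms by auto
  obtain q r where qr: "pseudo_divmod f g = (q, r)"
    by fastforce
  have f: "f = g * q + r" and r: "r = 0 \<or> degree r < degree g"
    using pseudo_divmod[OF g0 qr] assms by auto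
  have "map_poly of_int g dvd (map_poly of_int r :: complex poly)"
    using dvd unfolding f of_int_poly_hom.hom_add of_int_poly_hom.hom_mult
    by (simp add: dvd_add_right_iff)
  with r have "r = 0"
    by (auto dest: dvd_imp_degree_le)
  with f show ?thesis
    by simp
qed

text \<open>The roots of X^n - 1 are partitioned by their exact order \<open>d\<close>, a divisor of
  \<open>n\<close>. By induction the proper divisors account for all factors except those of the
  primitive roots.\<close>

lemma cyclotomic_poly_complex:
  assumes "n > 0"
  shows "map_poly of_int (cyclotomic_poly n) =
      (\<Prod>z | primitive_root n z. [:- z, 1:] :: complex poly)"
    and "(\<Prod>d | d dvd n. cyclotomic_poly d) = monom 1 n - 1"
proof -
  let ?h = "map_poly of_int :: int poly \<Rightarrow> complex poly"
  have "?h (cyclotomic_poly n) = (\<Prod>z | primitive_root n z. [:- z, 1:]) \<and>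
      (\<Prod>d | d dvd n. cyclotomic_poly d) = monom 1 n - 1"
    using assms
  proof (induction n rule: less_induct)
    case (less n)
    let ?C = "\<lambda>d. \<Prod>z | primitive_root d z. [:- z, 1 :: complex:]"
    let ?D = "{d. d dvd n \<and> d < n}"
    let ?P = "\<Prod>d\<in>?D. cyclotomic_poly d"
    have D: "{d. d dvd n} = insert n ?D"
      using less.prems by (auto dest: dvd_imp_le)
    have finU: "finite {z :: complex. z ^ n = 1}"
      using less.prems card_roots_unity_eq[of n] by (metis card.infinite less_irrefl)
    have sub: "{z :: complex. primitive_root d z} \<subseteq> {z. z ^ n = 1}" if "d dvd n" for d
      using that by (auto simp: primitive_root_def elim!: dvdE) (simp add: power_mult)
    have fin: "finite {z :: complex. primitive_root d z}" if "d dvd n" for d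
      using finite_subset[OF sub[OF that] finU] .
    have U: "{z :: complex. z ^ n = 1} = (\<Union>d\<in>{d. d dvd n}. {z. primitive_root d z})"
    proof (intro equalityI subsetI)
      fix z :: complex assume z: "z \<in> {z. z ^ n = 1}"
      \<comment> \<open>The order of \<open>z\<close>, sought only among the divisors of
        \<open>n\<close>; this suffices because \<open>primitive_rootI\<close> tests only
        divisors.\<close>
      define d where "d = (LEAST d. d dvd n \<and> z ^ d = 1)"
      have "d dvd n \<and> z ^ d = 1"
        unfolding d_def using z LeastI[of "\<lambda>d. d dvd n \<and> z ^ d = 1" n] by simp
      moreover have "z ^ e \<noteq> 1" if "e dvd d" "e < d" for e
        using not_less_Least[of e "\<lambda>d. d dvd n \<and> z ^ d = 1"] that calculation
        unfolding d_def[symmetric] by (meson dvd_trans)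
      ultimately have "primitive_root d z"
        using less.prems by (intro primitive_rootI) (auto intro: dvd_pos_nat)
      with \<open>d dvd n \<and> z ^ d = 1\<close> show "z \<in> (\<Union>d\<in>{d. d dvd n}. {z. primitive_root d z})"
        by auto
    qed (use sub in auto)
    have root: "poly (monom 1 n - 1) z = 0 \<longleftrightarrow> z ^ n = 1" for z :: complex
      by (simp add: poly_monom)
    have "monom 1 n - 1 = (\<Prod>z | z ^ n = 1. [:- z, 1 :: complex:])"
      using degree_monom_minus_one[OF less.prems, where 'a = complex] card_roots_unity_eq[OF less.prems] finU
      by (intro monic_eq_prod_roots) (auto simp: root simp del: poly_diff)
    also have "\<dots> = (\<Prod>d | d dvd n. ?C d)"
      unfolding U
    proof (intro prod.UNION_disjoint ballI impI)
      show "{z :: complex. primitive_root i z} \<inter> {z. primitive_root j z} = {}" if "i \<noteq> j" for i j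
        using that dvd_antisym unfolding primitive_root_def by blast
    qed (use less.prems fin in auto)
    also have "\<dots> = ?C n * (\<Prod>d\<in>?D. ?C d)"
      unfolding D using less.prems by (subst prod.insert) auto
    also have "(\<Prod>d\<in>?D. ?C d) = (\<Prod>d\<in>?D. ?h (cyclotomic_poly d))"
      using less.IH less.prems by (intro prod.cong refl) (auto intro: dvd_pos_nat)
    also have "\<dots> = ?h ?P"
      by (simp add: of_int_poly_hom.hom_prod)
    finally have eq: "monom 1 n - 1 = ?C n * ?h ?P" .
    have h_monom: "?h (monom 1 n - 1) = monom 1 n - 1"
      by (simp add: of_int_poly_hom.hom_minus)
    \<comment> \<open>Both X^n - 1 and \<open>?C n\<close> are monic, so the cofactor
      \<open>?P\<close> is monic too, and divisibility by it descends to the integers.\<close>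
    have "lead_coeff (?h ?P) = 1"
      using arg_cong[OF eq, of lead_coeff] degree_monom_minus_one(2)[OF less.prems, where 'a = complex]
      by (simp add: lead_coeff_mult lead_coeff_prod)
    then have lc: "lead_coeff ?P = 1"
      by simp
    have "?P dvd monom 1 n - 1"
      by (rule dvd_monic_int_poly[OF lc]) (simp only: h_monom eq dvd_triv_right)
    then have exact: "cyclotomic_poly n * ?P = monom 1 n - 1"
      by (subst cyclotomic_poly.simps) simp
    have "?h (cyclotomic_poly n) * ?h ?P = ?C n * ?h ?P"
      using arg_cong[OF exact, of ?h] eq h_monom by (simp add: of_int_poly_hom.hom_mult)
    moreover have "?h ?P \<noteq> 0"
      using \<open>lead_coeff (?h ?P) = 1\<close> by (metis leading_coeff_0_iff zero_neq_one)
    ultimately have "?h (cyclotomic_poly n) = ?C n"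
      using mult_right_cancel by blast
    moreover have "(\<Prod>d | d dvd n. cyclotomic_poly d) = monom 1 n - 1"
      unfolding D exact[symmetric] using less.prems by (subst prod.insert) auto
    ultimately show ?case
      by blast
  qed
  then show "?h (cyclotomic_poly n) = (\<Prod>z | primitive_root n z. [:- z, 1:])"
    and "(\<Prod>d | d dvd n. cyclotomic_poly d) = monom 1 n - 1"
    by auto
qed

lemma cyclotomic_poly_monic:
  assumes "n > 0"
  shows "lead_coeff (cyclotomic_poly n) = 1"
  using arg_cong[OF cyclotomic_poly_complex(1)[OF assms], of lead_coeff]
  by (simp add: lead_coeff_prod)

text \<open>A constant monic polynomial is \<open>1\<close> and has no roots, but
  \<open>cis (2 * pi / n)\<close> is a primitive root of unity and hence a root.\<close>

lemma degree_cyclotomic_poly_pos: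
  assumes "n > 0"
  shows "degree (cyclotomic_poly n) > 0"
proof (rule ccontr)
  assume "\<not> ?thesis"
  then have 1: "cyclotomic_poly n = 1"
    using cyclotomic_poly_monic[OF assms] by (auto elim: degree_eq_zeroE)
  define w where "w = cis (2 * pi / real n)"
  have "primitive_root n w"
  proof (rule primitive_rootI[OF assms])
    have w_pow: "w ^ k = cis (2 * pi * real k / real n)" for k
      by (simp add: w_def DeMoivre mult_ac)
    show "w ^ n = 1"
      using assms by (simp add: w_pow)
    show "w ^ d \<noteq> 1" if "d dvd n" "d < n" for d
    proof
      assume "w ^ d = 1"
      moreover have "inj_on (\<lambda>k. cis (2 * pi * real k / real n)) {..<n}"
        using bij_betw_roots_unity[OF assms] by (rule bij_betw_imp_inj_on)
      ultimately have "d = 0"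
        using that assms unfolding w_pow by (auto dest: inj_onD[of _ _ d 0])
      with that assms show False
        by simp
    qed
  qed
  have fin: "finite {z :: complex. primitive_root n z}"
    by (rule finite_subset[of _ "{z. z ^ n = 1}"])
      (use assms card_roots_unity_eq[of n] in \<open>auto simp: primitive_root_def intro: card_ge_0_finite\<close>)
  have "poly (map_poly of_int (cyclotomic_poly n)) w = 0"
    unfolding cyclotomic_poly_complex(1)[OF assms] using \<open>primitive_root n w\<close> fin by (auto simp: poly_prod)
  with 1 show False
    by simp
qed

lemma cyclotomic_poly_dvd:
  assumes "n > 0"
  shows "cyclotomic_poly n dvd monom 1 n - 1"
  unfolding cyclotomic_poly_complex(2)[OF assms, symmetric]
  using assms by (intro dvd_prodI) auto

text \<open>If the order of \<open>\<zeta>\<close> were a proper divisor \<open>d\<close> of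
  \<open>n\<close>, then \<open>\<zeta>\<close> would be a double root of X^n - 1. This polynomial
  is separable because \<open>n\<close> is nonzero in the field.\<close>

lemma cyclotomic_root_primitive:
  fixes \<zeta> :: "'a::field"
  assumes "n > 0" "of_nat n \<noteq> (0 :: 'a)"
    and root: "poly (map_poly of_int (cyclotomic_poly n)) \<zeta> = 0"
  shows "primitive_root n \<zeta>"
proof (rule primitive_rootI)
  let ?h = "map_poly of_int :: int poly \<Rightarrow> 'a poly"
  have h_monom: "?h (monom 1 k - 1) = monom 1 k - 1" for k
    by (simp add: of_int_poly_hom.hom_minus)
  have fin: "finite {d. d dvd n}"
    using assms by simp
  obtain q where q: "monom 1 n - 1 = cyclotomic_poly n * q"
    using cyclotomic_poly_dvd[OF \<open>n > 0\<close>] by (elim dvdE)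
  have "poly (?h (monom 1 n - 1)) \<zeta> = 0"
    unfolding q by (simp add: of_int_poly_hom.hom_mult root)
  then show "\<zeta> ^ n = 1"
    unfolding h_monom by (simp add: poly_monom)
  show "\<zeta> ^ d \<noteq> 1" if d: "d dvd n" "d < n" for d
  proof
    assume 1: "\<zeta> ^ d = 1"
    have "d > 0"
      using d \<open>n > 0\<close> by (auto intro: dvd_pos_nat)
    \<comment> \<open>The factors of X^d - 1 and the factor for \<open>n\<close> occur at different
      indices in the factorization of X^n - 1, so their product still divides it.\<close>
    have "(\<Prod>e | e dvd d. cyclotomic_poly e) * cyclotomic_poly n =
        (\<Prod>e\<in>insert n {e. e dvd d}. cyclotomic_poly e)"
      using d \<open>d > 0\<close> by (subst prod.insert) (auto dest: dvd_imp_le simp: mult.commute)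
    also have "\<dots> dvd (\<Prod>e | e dvd n. cyclotomic_poly e)"
      using fin d by (intro prod_dvd_prod_subset) (auto intro: dvd_trans)
    finally have "(monom 1 d - 1) * cyclotomic_poly n dvd monom 1 n - 1"
      using \<open>n > 0\<close> \<open>d > 0\<close> by (simp add: cyclotomic_poly_complex(2))
    then obtain q where q: "monom 1 n - 1 = (monom 1 d - 1) * cyclotomic_poly n * q" ..
    have "monom 1 n - 1 = (monom 1 d - 1) * ?h (cyclotomic_poly n) * ?h q"
      using arg_cong[OF q, of ?h] h_monom by (simp add: of_int_poly_hom.hom_mult)
    \<comment> \<open>Two factors on the right vanish at \<open>\<zeta>\<close>, so each term of the
      product rule keeps a vanishing factor.\<close>
    from arg_cong[OF this, of "\<lambda>f. poly (pderiv f) \<zeta>"]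
    have "of_nat n * \<zeta> ^ (n - 1) = 0"
      using 1 root by (simp add: pderiv_mult pderiv_diff pderiv_monom poly_monom)
    then have "\<zeta> = 0"
      using assms by simp
    with \<open>\<zeta> ^ n = 1\<close> \<open>n > 0\<close> show False
      by (simp add: power_0_left)
  qed
qed (fact \<open>n > 0\<close>)

text \<open>A monic integer polynomial keeps its degree when its coefficients are mapped to a field
  of any characteristic.\<close>

lemma ex_cyclotomic_root:
  assumes "n > 0"
  shows "\<exists>\<zeta> :: 'a::alg_closed_field. poly (map_poly of_int (cyclotomic_poly n)) \<zeta> = 0"
proof (rule alg_closed_imp_poly_has_root)
  have "degree (map_poly of_int (cyclotomic_poly n) :: 'a poly) = degree (cyclotomic_poly n)"
    using cyclotomic_poly_monic[OF assms] by (intro degree_map_poly) auto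
  then show "0 < degree (map_poly of_int (cyclotomic_poly n) :: 'a poly)"
    using degree_cyclotomic_poly_pos[OF assms] by simp
qed

section \<open>Galois conjugates of a primitive root of unity\<close>

interpretation to_ac_hom: field_hom to_ac
  by unfold_locales auto

interpretation to_ac_poly_hom: map_poly_inj_idom_hom to_ac ..

lemma primitive_root_pow_eq_iff:
  fixes z :: "'a::field"
  assumes "primitive_root n z" "n > 0"
  shows "z ^ i = z ^ j \<longleftrightarrow> i mod n = j mod n"
proof -
  have *: "z ^ i = z ^ j \<longleftrightarrow> i mod n = j mod n" if "i \<le> j" for i j
  proof -
    have z: "z \<noteq> 0"
      using assms by (auto simp: primitive_root_def power_0_left)
    have "z ^ j = z ^ i * z ^ (j - i)"
      using that by (simp flip: power_add)
    then have "z ^ i = z ^ j \<longleftrightarrow> z ^ (j - i) = 1"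
      using z by auto
    also have "\<dots> \<longleftrightarrow> n dvd j - i"
      using assms by (auto simp: primitive_root_def elim!: dvdE) (simp add: power_mult)
    also have "\<dots> \<longleftrightarrow> i mod n = j mod n"
      using that by (metis mod_eq_dvd_iff_nat)
    finally show ?thesis .
  qed
  show ?thesis
    using *[of i j] *[of j i] by (metis linorder_le_cases)
qed

text \<open>With \<open>g = gcd r n\<close>, the power \<open>z ^ r\<close> is already killed by the
  exponent \<open>n div g\<close>, which \<open>n\<close> must then divide.\<close>

lemma primitive_root_power_coprime:
  fixes z :: "'a::field"
  assumes "primitive_root n z" "primitive_root n (z ^ r)" "n > 0"
  shows "coprime r n"
proof -
  define g where "g = gcd r n"
  have "r * (n div g) = n * (r div g)"
    by (metis g_def div_mult_swap mult.commute gcd_dvd1 gcd_dvd2)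
  then have "(z ^ r) ^ (n div g) = (z ^ n) ^ (r div g)"
    by (simp flip: power_mult)
  then have "n dvd n div g"
    using assms by (simp add: primitive_root_def)
  moreover have "g dvd n"
    by (simp add: g_def)
  ultimately have "g = 1"
    using \<open>n > 0\<close>
    by (metis dvd_div_eq_0_iff dvd_imp_le div_less_dividend gcd_nat.extremum linorder_not_less
        g_def gcd_pos_nat nat_neq_iff less_one not_gr0 bot_nat_0.not_eq_extremum)
  then show ?thesis
    by (simp add: g_def coprime_iff_gcd_eq_1)
qed

lemma primitive_root_sum:
  fixes z :: "'a::field"
  assumes "z ^ n = 1"
  shows "(\<Sum>j<n. z ^ j) = (if z = 1 then of_nat n else 0)"
  using assms by (auto simp: sum_gp_strict)

text \<open>A polynomial of least degree vanishing at \<open>\<zeta>\<close> divides every other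
  one, since the remainder vanishes there too. It is irreducible: a factor vanishing at
  \<open>\<zeta>\<close> is a multiple of the whole, so its cofactor is a unit.\<close>

lemma ex_minimal_polynomial:
  fixes \<zeta> :: "'f::field alg_closure"
  assumes "f \<noteq> 0" "poly (map_poly to_ac f) \<zeta> = 0"
  obtains p :: "'f poly" where "lead_coeff p = 1" "Factorial_Ring.irreducible p"
    "poly (map_poly to_ac p) \<zeta> = 0" "\<And>f. poly (map_poly to_ac f) \<zeta> = 0 \<Longrightarrow> p dvd f"
proof -
  define P where "P p \<longleftrightarrow> p \<noteq> 0 \<and> poly (map_poly to_ac p) \<zeta> = 0" for p :: "'f poly"
  obtain p where "P p" and min: "\<And>q. P q \<Longrightarrow> degree p \<le> degree q"
    using ex_has_least_nat[of P f degree] assms by (auto simp: P_def)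
  then have p0: "p \<noteq> 0" and p: "poly (map_poly to_ac p) \<zeta> = 0"
    by (auto simp: P_def)
  have dvd: "p dvd f" if f: "poly (map_poly to_ac f) \<zeta> = 0" for f
  proof -
    have "poly (map_poly to_ac (f mod p)) \<zeta> = 0"
    proof -
      have "f mod p = f - p * (f div p)"
        by (simp add: minus_mult_div_eq_mod)
      then show ?thesis
        using f p by (simp add: to_ac_poly_hom.hom_minus to_ac_poly_hom.hom_mult)
    qed
    then have "f mod p = 0"
      using min[of "f mod p"] degree_mod_less[OF p0, of f] by (fastforce simp: P_def)
    then show ?thesis
      by auto
  qed
  define m where "m = smult (inverse (lead_coeff p)) p"
  have m0: "m \<noteq> 0" and lc: "lead_coeff m = 1" and m: "poly (map_poly to_ac m) \<zeta> = 0"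
    using p0 p by (auto simp: m_def to_ac_hom.map_poly_hom_smult)
  have m_dvd: "m dvd f" if "poly (map_poly to_ac f) \<zeta> = 0" for f
    using dvd[OF that] p0 by (simp add: m_def smult_dvd_iff)
  have "Factorial_Ring.irreducible m"
  proof (rule Factorial_Ring.irreducibleI[OF m0])
    show "\<not> m dvd 1"
    proof
      assume "m dvd 1"
      then have "degree m = 0"
        using m0 by (simp add: is_unit_iff_degree)
      then obtain c where "m = [:c:]"
        by (elim degree_eq_zeroE)
      with m m0 show False
        by simp
    qed
    fix a b assume ab: "m = a * b"
    have *: "b dvd 1" if ab: "m = a * b" and a: "poly (map_poly to_ac a) \<zeta> = 0" for a b
    proof -
      have "a * b dvd a * 1"
        using m_dvd[OF a] ab by simp
      moreover have "a \<noteq> 0"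
        using ab m0 by auto
      ultimately show ?thesis
        using dvd_mult_cancel_left by blast
    qed
    have "poly (map_poly to_ac a) \<zeta> = 0 \<or> poly (map_poly to_ac b) \<zeta> = 0"
      using m unfolding ab by (simp add: to_ac_poly_hom.hom_mult)
    then show "a dvd 1 \<or> b dvd 1"
      using *[of a b] *[of b a] ab by (auto simp: mult.commute)
  qed
  with lc m m_dvd show thesis
    using that by blast
qed

text \<open>Galois theory of the extension generated by \<open>\<zeta>\<close>, phrased without
  automorphisms. The exponents stand for the maps sending \<open>\<zeta>\<close> to
  \<open>\<zeta> ^ r\<close>: \<open>closed\<close> is closure under composition,
  \<open>conjugate_root\<close> says that such maps respect polynomial relations, and
  \<open>descent\<close> says that values fixed by all of them lie in the ground field.\<close>

locale galois_exponents =
  fixes \<zeta> :: "'f::field alg_closure" and n :: nat and rs :: "nat list"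
  assumes n_pos: "n > 0" and n_nonzero: "of_nat n \<noteq> (0 :: 'f)"
    and prim: "primitive_root n \<zeta>"
    and one_mem: "1 \<in> set rs"
    and coprime_exponent: "r \<in> set rs \<Longrightarrow> coprime r n"
    and closed: "r \<in> set rs \<Longrightarrow> u \<in> set rs \<Longrightarrow> \<exists>t\<in>set rs. (r * u) mod n = t mod n"
    and conjugate_root: "r \<in> set rs \<Longrightarrow> poly (map_poly to_ac f) \<zeta> = 0 \<Longrightarrow>
      poly (map_poly to_ac f) (\<zeta> ^ r) = 0"
    and descent: "(\<And>r. r \<in> set rs \<Longrightarrow> poly (map_poly to_ac f) (\<zeta> ^ r) = v) \<Longrightarrow>
      v \<in> range to_ac"

lemma ex_galois_exponents:
  assumes seq: "cyclotomic_sequence TYPE('f::field) n rs"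
    and n: "n > 0" "of_nat n \<noteq> (0 :: 'f)"
  shows "\<exists>\<zeta> :: 'f alg_closure. galois_exponents \<zeta> n rs"
proof -
  let ?\<Phi> = "map_poly of_int (cyclotomic_poly n) :: 'f poly"
  let ?\<Phi>' = "map_poly of_int (cyclotomic_poly n) :: 'f alg_closure poly"
  let ?h = "map_poly to_ac :: 'f poly \<Rightarrow> 'f alg_closure poly"
  have n': "of_nat n \<noteq> (0 :: 'f alg_closure)"
    using n by (metis to_ac_eq_0_iff to_ac_of_nat)
  have \<Phi>': "?h ?\<Phi> = ?\<Phi>'"
    by (simp add: map_poly_map_poly o_def)
  obtain \<zeta> :: "'f alg_closure" where \<zeta>: "poly ?\<Phi>' \<zeta> = 0"
    using ex_cyclotomic_root[OF n(1)] by blast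
  note prim = cyclotomic_root_primitive[OF n(1) n' \<zeta>]
  have "?\<Phi> \<noteq> 0"
    using cyclotomic_poly_monic[OF n(1)] by (metis degree_map_poly leading_coeff_0_iff of_int_1
      coeff_map_poly of_int_0 one_neq_zero)
  then obtain p where p: "lead_coeff p = 1" "Factorial_Ring.irreducible p"
    "poly (?h p) \<zeta> = 0" and p_dvd: "\<And>f. poly (?h f) \<zeta> = 0 \<Longrightarrow> p dvd f"
    using ex_minimal_polynomial[of ?\<Phi> \<zeta>] \<zeta> \<Phi>' by metis
  have p\<Phi>: "p dvd ?\<Phi>"
    using p_dvd \<zeta> \<Phi>' by metis
  obtain q' where "monom 1 n - 1 = cyclotomic_poly n * q'"
    using cyclotomic_poly_dvd[OF n(1)] by (elim dvdE)
  from arg_cong[OF this, of "map_poly of_int :: int poly \<Rightarrow> 'f poly"]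
  have "?\<Phi> dvd monom 1 n - 1"
    by (simp add: of_int_poly_hom.hom_minus of_int_poly_hom.hom_mult)
  with p\<Phi> obtain q where q: "monom 1 n - 1 = p * q"
    by (meson dvd_trans dvdE)
  have roots: "{z. poly (?h p) z = 0} = (\<lambda>r. \<zeta> ^ r) ` set rs"
    and rs: "rs \<noteq> []" "hd rs = 1"
    using seq[unfolded cyclotomic_sequence_def] \<zeta> p p\<Phi> by auto
  have root: "poly (?h p) (\<zeta> ^ r) = 0" if "r \<in> set rs" for r
    using roots that by blast
  show ?thesis
  proof (intro exI[of _ \<zeta>] galois_exponents.intro n prim)
    show "1 \<in> set rs"
      using rs by (metis hd_in_set)
    show conj: "poly (?h f) (\<zeta> ^ r) = 0" if "r \<in> set rs" "poly (?h f) \<zeta> = 0" for r f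
      using p_dvd[OF that(2)] root[OF that(1)] by (auto simp: to_ac_poly_hom.hom_mult elim!: dvdE)
    show "coprime r n" if "r \<in> set rs" for r
    proof -
      have "poly ?\<Phi>' (\<zeta> ^ r) = 0"
        using conj[OF that, of ?\<Phi>] \<zeta> \<Phi>' by simp
      then show ?thesis
        using cyclotomic_root_primitive[OF n(1) n'] primitive_root_power_coprime prim n by blast
    qed
    show "\<exists>t\<in>set rs. (r * u) mod n = t mod n" if "r \<in> set rs" "u \<in> set rs" for r u
    proof -
      \<comment> \<open>As \<open>\<zeta> ^ r\<close> is a root of \<open>p\<close>, the polynomial
        p(X^r) vanishes at \<open>\<zeta>\<close>, hence at its conjugate
        \<open>\<zeta> ^ u\<close>. So \<open>\<zeta> ^ (r * u)\<close> is again a root of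
        \<open>p\<close>.\<close>
      have comp: "poly (?h (p \<circ>\<^sub>p monom 1 r)) z = poly (?h p) (z ^ r)" for z
        by (simp add: to_ac_hom.map_poly_pcompose poly_pcompose poly_monom)
      have "poly (?h (p \<circ>\<^sub>p monom 1 r)) (\<zeta> ^ u) = 0"
        using that by (intro conj) (simp_all add: comp root)
      then have "poly (?h p) (\<zeta> ^ (r * u)) = 0"
        by (simp add: comp power_mult[symmetric] mult.commute)
      then obtain t where "t \<in> set rs" "\<zeta> ^ (r * u) = \<zeta> ^ t"
        using roots by blast
      then show ?thesis
        using primitive_root_pow_eq_iff[OF prim n(1)] by blast
    qed
    show "v \<in> range to_ac"
      if v: "\<And>r. r \<in> set rs \<Longrightarrow> poly (?h f) (\<zeta> ^ r) = v" for f v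
    proof -
      let ?A = "(\<lambda>r. \<zeta> ^ r) ` set rs"
      let ?Z = "(\<lambda>b. \<zeta> ^ b) ` {..<n}"
      have hq: "monom 1 n - 1 = ?h p * ?h q"
        using arg_cong[OF q, of ?h] by (simp add: to_ac_poly_hom.hom_minus to_ac_poly_hom.hom_mult)
      have pq0: "p \<noteq> 0" "q \<noteq> 0"
        using q degree_monom_minus_one[OF n(1), where 'a = 'f] n by auto
      have deg: "degree p + degree q = n"
        using arg_cong[OF q, of degree] degree_monom_minus_one(1)[OF n(1), where 'a = 'f] pq0
        by (simp add: degree_mult_eq)
      have inj: "inj_on (\<lambda>b. \<zeta> ^ b) {..<n}"
        by (rule inj_onI) (simp add: primitive_root_pow_eq_iff[OF prim n(1)])
      have fin: "finite {z. poly (?h q) z = 0}" "finite ?A"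
        using pq0 by (auto intro: poly_roots_finite)
      \<comment> \<open>Counting gives separability of \<open>p\<close>: the \<open>n\<close>
        distinct roots of X^n - 1 = p q are roots of \<open>p\<close> or of \<open>q\<close>, and
        \<open>q\<close> has at most \<open>degree q\<close> of them. So \<open>p\<close> has at
        least \<open>degree p\<close> distinct roots.\<close>
      have "?Z \<subseteq> ?A \<union> {z. poly (?h q) z = 0}"
      proof
        fix z assume "z \<in> ?Z"
        then have "z ^ n = 1"
          using prim by (auto simp: primitive_root_def) (metis mult.commute power_mult power_one)
        then have "poly (?h p * ?h q) z = 0"
          unfolding hq[symmetric] by (simp add: poly_monom)
        then show "z \<in> ?A \<union> {z. poly (?h q) z = 0}"
          using roots by auto
      qed
      then have "card ?Z \<le> card (?A \<union> {z. poly (?h q) z = 0})"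
        using fin by (intro card_mono) auto
      also have "\<dots> \<le> card ?A + card {z. poly (?h q) z = 0}"
        by (rule card_Un_le)
      also have "card {z. poly (?h q) z = 0} \<le> degree q"
        using card_poly_roots_bound[of "?h q"] pq0 by simp
      finally have deg_p: "degree p \<le> card ?A"
        using deg inj by (simp add: card_image)
      have "degree p > 0"
        using p by (auto elim!: degree_eq_zeroE intro!: gr0I)
      \<comment> \<open>Reduction modulo \<open>p\<close> keeps the values at the conjugates and
        pushes the degree below their number. A polynomial taking the value \<open>v\<close> at all
        of them is then the constant \<open>v\<close>, and its coefficient lies in the ground
        field.\<close>
      define g where "g = f mod p"
      have "poly (?h g) z = poly [:v:] z" if "z \<in> ?A" for z
      proof -
        have "poly (?h p) z = 0"
          using that root by auto
        moreover have "g = f - p * (f div p)"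
          by (simp add: g_def minus_mult_div_eq_mod)
        ultimately show ?thesis
          using that v by (auto simp: to_ac_poly_hom.hom_minus to_ac_poly_hom.hom_mult)
      qed
      moreover have "degree (?h g) < card ?A"
        using degree_mod_less[OF pq0(1), of f] \<open>degree p > 0\<close> deg_p by (auto simp: g_def)
      moreover have "degree [:v:] < card ?A"
        using \<open>degree p > 0\<close> deg_p by simp
      ultimately have "?h g = [:v:]"
        by (rule poly_eqI_degree)
      from arg_cong[OF this, of "\<lambda>p. coeff p 0"] have "to_ac (coeff g 0) = v"
        by simp
      then show ?thesis
        by blast
    qed
  qed
qed

section \<open>Traces of powers\<close>

text \<open>
  A rank-one idempotent is split off that leaves the remaining idempotent with one more zero row.
\<close>

lemma trace_idempotent:
  fixes P :: "'i \<Rightarrow> 'i \<Rightarrow> 'a::field"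
  assumes "finite I"
    and "\<And>i k. i \<in> I \<Longrightarrow> k \<in> I \<Longrightarrow> (\<Sum>j\<in>I. P i j * P j k) = P i k"
  shows "\<exists>m. (\<Sum>i\<in>I. P i i) = of_nat m"
  using assms(2)
proof (induction "card {i\<in>I. \<exists>j\<in>I. P i j \<noteq> 0}" arbitrary: P rule: less_induct)
  case (less P)
  show ?case
  proof (cases "\<exists>a\<in>I. \<exists>b\<in>I. P a b \<noteq> 0")
    case False
    then have "(\<Sum>i\<in>I. P i i) = of_nat 0"
      by (simp add: sum.neutral)
    then show ?thesis ..
  next
    case True
    then obtain a b where ab: "a \<in> I" "b \<in> I" "P a b \<noteq> 0"
      by blast
    define c where "c = P a b"
    have c: "c \<noteq> 0"
      using ab by (simp add: c_def)
    define Q where "Q i k = P i k - P i b * P a k / c" for i k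
    have "{i\<in>I. \<exists>j\<in>I. Q i j \<noteq> 0} \<subset> {i\<in>I. \<exists>j\<in>I. P i j \<noteq> 0}"
    proof
      have "P i b \<noteq> 0" if "i \<in> I" "j \<in> I" "Q i j \<noteq> 0" "P i j = 0" for i j
        using that by (auto simp: Q_def)
      then show "{i\<in>I. \<exists>j\<in>I. Q i j \<noteq> 0} \<subseteq> {i\<in>I. \<exists>j\<in>I. P i j \<noteq> 0}"
        using ab by blast
      have "a \<notin> {i\<in>I. \<exists>j\<in>I. Q i j \<noteq> 0}" "a \<in> {i\<in>I. \<exists>j\<in>I. P i j \<noteq> 0}"
        using ab by (auto simp: Q_def c_def)
      then show "{i\<in>I. \<exists>j\<in>I. Q i j \<noteq> 0} \<noteq> {i\<in>I. \<exists>j\<in>I. P i j \<noteq> 0}"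
        by blast
    qed
    then have "card {i\<in>I. \<exists>j\<in>I. Q i j \<noteq> 0} < card {i\<in>I. \<exists>j\<in>I. P i j \<noteq> 0}"
      using \<open>finite I\<close> by (intro psubset_card_mono) auto
    moreover have "(\<Sum>j\<in>I. Q i j * Q j k) = Q i k" if "i \<in> I" "k \<in> I" for i k
    proof -
      have "(\<Sum>j\<in>I. Q i j * Q j k) = (\<Sum>j\<in>I. P i j * P j k) - (\<Sum>j\<in>I. P i j * P j b) * P a k / c
          - P i b / c * (\<Sum>j\<in>I. P a j * P j k) + P i b / c * (\<Sum>j\<in>I. P a j * P j b) * P a k / c"
        by (simp add: Q_def algebra_simps sum_distrib_left sum_distrib_right sum_divide_distrib
            sum.distrib sum_subtractf)
      also have "\<dots> = P i k - P i b * P a k / c - P i b / c * P a k + P i b / c * c * P a k / c"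
        using less.prems ab that by (simp add: c_def)
      finally show ?thesis
        using c by (simp add: Q_def)
    qed
    ultimately obtain m where m: "(\<Sum>i\<in>I. Q i i) = of_nat m"
      using less.hyps[of Q] by blast
    have "(\<Sum>i\<in>I. Q i i) = (\<Sum>i\<in>I. P i i) - (\<Sum>i\<in>I. P a i * P i b) / c"
      by (simp add: Q_def sum_subtractf sum_divide_distrib mult.commute)
    \<comment> \<open>By idempotence the sum is the entry \<open>P a b\<close>, so the split-off
      part has trace one.\<close>
    also have "(\<Sum>i\<in>I. P a i * P i b) / c = 1"
      using less.prems ab c by (simp add: c_def)
    finally have "(\<Sum>i\<in>I. P i i) = of_nat (Suc m)"
      using m by (simp add: algebra_simps)
    then show ?thesis ..
  qed
qed

lemma sum_periodic_shift:
  fixes h :: "nat \<Rightarrow> 'a::comm_monoid_add"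
  assumes "n > 0" and per: "\<And>s. h (s mod n) = h s"
  shows "(\<Sum>t<n. h (s + t)) = (\<Sum>t<n. h t)"
proof (rule sum.reindex_bij_witness[where i = "\<lambda>t. (t + (n - s mod n)) mod n" and j = "\<lambda>t. (s + t) mod n"])
  have le: "s mod n \<le> n"
    using assms by (simp add: less_imp_le)
  fix t assume t: "t \<in> {..<n}"
  show "(s + t) mod n \<in> {..<n}" "h ((s + t) mod n) = h (s + t)"
    "(t + (n - s mod n)) mod n \<in> {..<n}"
    using assms by auto
  have "((s + t) mod n + (n - s mod n)) mod n = (s mod n + t + (n - s mod n)) mod n"
    by (metis add.assoc mod_add_left_eq mod_add_right_eq)
  also have "s mod n + t + (n - s mod n) = t + n"
    using le by simp
  finally show "((s + t) mod n + (n - s mod n)) mod n = t"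
    using t by simp
  have "(s + (t + (n - s mod n)) mod n) mod n = (s mod n + (t + (n - s mod n))) mod n"
    by (metis add.assoc mod_add_left_eq mod_add_right_eq)
  also have "s mod n + (t + (n - s mod n)) = t + n"
    using le by simp
  finally show "(s + (t + (n - s mod n)) mod n) mod n = t"
    using t by simp
qed

text \<open>A geometric sum with ratio \<open>w\<close>, where \<open>w = 1\<close> exactly when the
  two exponents agree modulo \<open>n\<close>.\<close>

lemma primitive_root_orthogonality:
  fixes \<zeta> :: "'a::field"
  assumes "primitive_root n \<zeta>" "n > 0"
  shows "(\<Sum>b<n. \<zeta> ^ (b * k) * inverse \<zeta> ^ (b * s)) = (if k mod n = s mod n then of_nat n else 0)"
proof -
  have z: "\<zeta> \<noteq> 0"
    using assms by (auto simp: primitive_root_def power_0_left)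
  define w where "w = \<zeta> ^ k * inverse \<zeta> ^ s"
  have "\<zeta> ^ n = 1"
    using assms by (simp add: primitive_root_def)
  have "w ^ n = (\<zeta> ^ n) ^ k * inverse (\<zeta> ^ n) ^ s"
    by (simp add: w_def power_mult_distrib mult.commute flip: power_mult power_inverse)
  then have "w ^ n = 1"
    using \<open>\<zeta> ^ n = 1\<close> by simp
  have "(\<Sum>b<n. \<zeta> ^ (b * k) * inverse \<zeta> ^ (b * s)) = (\<Sum>b<n. w ^ b)"
    by (intro sum.cong) (simp_all add: w_def power_mult_distrib mult.commute flip: power_mult)
  also have "\<dots> = (if w = 1 then of_nat n else 0)"
    by (rule primitive_root_sum) fact
  also have "w = 1 \<longleftrightarrow> \<zeta> ^ k = \<zeta> ^ s"
    using z by (simp add: w_def field_simps)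
  also have "\<dots> \<longleftrightarrow> k mod n = s mod n"
    by (rule primitive_root_pow_eq_iff) fact+
  finally show ?thesis .
qed

text \<open>Here \<open>a k\<close> is the k-th power of one matrix, and \<open>P b\<close> is its
  spectral projection for the eigenvalue \<open>\<zeta> ^ b\<close>. The traces of these idempotents
  give multiplicities \<open>m b\<close> that do not depend on \<open>k\<close>, and Fourier
  inversion recovers every \<open>a k\<close> from the projections.\<close>

lemma trace_cyclic_representation:
  fixes a :: "nat \<Rightarrow> 'i \<Rightarrow> 'i \<Rightarrow> 'a::field"
  assumes "finite I" "n > 0" "of_nat n \<noteq> (0 :: 'a)" and prim: "primitive_root n \<zeta>"
    and mult: "\<And>s t i k. i \<in> I \<Longrightarrow> k \<in> I \<Longrightarrow> (\<Sum>j\<in>I. a s i j * a t j k) = a (s + t) i k"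
    and per: "\<And>s. a (s mod n) = a s"
  shows "\<exists>m. \<forall>k. (\<Sum>i\<in>I. a k i i) = (\<Sum>b<n. of_nat (m b) * \<zeta> ^ (b * k))"
proof -
  let ?N = "of_nat n :: 'a"
  define P where "P b i j = (\<Sum>s<n. inverse \<zeta> ^ (b * s) * a s i j) / ?N" for b i j
  have "(\<Sum>j\<in>I. P b i j * P b j k) = P b i k" if "i \<in> I" "k \<in> I" for b i k
  proof -
    define h where "h s = inverse \<zeta> ^ (b * s) * a s i k" for s
    have "(inverse \<zeta> ^ n) = 1"
      using prim by (simp add: primitive_root_def power_inverse)
    have h: "h (s mod n) = h s" for s
    proof -
      have "b * s = n * (b * (s div n)) + b * (s mod n)"
        by (metis distrib_left mult.left_commute mult_div_mod_eq)
      then have "inverse \<zeta> ^ (b * s) =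
          (inverse \<zeta> ^ n) ^ (b * (s div n)) * inverse \<zeta> ^ (b * (s mod n))"
        by (simp only: power_add power_mult)
      then have "inverse \<zeta> ^ (b * s) = inverse \<zeta> ^ (b * (s mod n))"
        unfolding \<open>inverse \<zeta> ^ n = 1\<close> by simp
      then show ?thesis
        by (simp add: h_def per)
    qed
    have "(\<Sum>j\<in>I. P b i j * P b j k) =
        (\<Sum>j\<in>I. \<Sum>s<n. \<Sum>t<n. inverse \<zeta> ^ (b * s + b * t) * (a s i j * a t j k)) / (?N * ?N)"
      unfolding P_def times_divide_times_eq sum_product sum_divide_distrib[symmetric]
      by (simp add: power_add mult_ac)
    also have "(\<Sum>j\<in>I. \<Sum>s<n. \<Sum>t<n. inverse \<zeta> ^ (b * s + b * t) * (a s i j * a t j k)) =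
        (\<Sum>s<n. \<Sum>t<n. \<Sum>j\<in>I. inverse \<zeta> ^ (b * s + b * t) * (a s i j * a t j k))"
      by (subst sum.swap, intro sum.cong refl, rule sum.swap)
    also have "\<dots> = (\<Sum>s<n. \<Sum>t<n. h (s + t))"
      using mult that by (simp add: h_def distrib_left flip: sum_distrib_left)
    \<comment> \<open>The summand depends only on \<open>s + t\<close> modulo \<open>n\<close>, so
      each of the \<open>n\<close> values of \<open>s\<close> contributes the same sum.\<close>
    also have "\<dots> = ?N * (\<Sum>t<n. h t)"
      by (subst sum_periodic_shift[of n h, OF \<open>n > 0\<close> h]) simp
    finally show ?thesis
      using assms(3) by (simp add: P_def h_def)
  qed
  then have "\<forall>b. \<exists>m. (\<Sum>i\<in>I. P b i i) = of_nat m"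
    by (intro allI trace_idempotent[OF \<open>finite I\<close>])
  then obtain m where m: "\<And>b. (\<Sum>i\<in>I. P b i i) = of_nat (m b)"
    by metis
  have inv: "(\<Sum>b<n. \<zeta> ^ (b * k) * P b i i) = a k i i" for k i
  proof -
    have "(\<Sum>b<n. \<zeta> ^ (b * k) * P b i i) =
        (\<Sum>b<n. \<Sum>s<n. \<zeta> ^ (b * k) * inverse \<zeta> ^ (b * s) * a s i i) / ?N"
      by (simp add: P_def sum_distrib_left sum_divide_distrib mult_ac)
    also have "(\<Sum>b<n. \<Sum>s<n. \<zeta> ^ (b * k) * inverse \<zeta> ^ (b * s) * a s i i) =
        (\<Sum>s<n. (\<Sum>b<n. \<zeta> ^ (b * k) * inverse \<zeta> ^ (b * s)) * a s i i)"
      by (subst sum.swap) (simp add: sum_distrib_right)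
    also have "\<dots> = (\<Sum>s<n. if k mod n = s then ?N * a s i i else 0)"
      unfolding primitive_root_orthogonality[OF prim \<open>n > 0\<close>] by (intro sum.cong) auto
    also have "\<dots> = ?N * a k i i"
      using \<open>n > 0\<close> by (simp add: per)
    finally show ?thesis
      using assms(3) by simp
  qed
  have "(\<Sum>i\<in>I. a k i i) = (\<Sum>b<n. of_nat (m b) * \<zeta> ^ (b * k))" for k
  proof -
    have "(\<Sum>i\<in>I. a k i i) = (\<Sum>i\<in>I. \<Sum>b<n. \<zeta> ^ (b * k) * P b i i)"
      by (simp add: inv)
    also have "\<dots> = (\<Sum>b<n. \<zeta> ^ (b * k) * (\<Sum>i\<in>I. P b i i))"
      by (subst sum.swap) (simp add: sum_distrib_left)
    finally show ?thesis
      by (simp add: m mult.commute)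
  qed
  then show ?thesis
    by blast
qed

section \<open>Characters of matrix representations\<close>

lemma mat_trace_mult_commute:
  fixes A B :: "'a::comm_semiring_0 mat"
  assumes "A \<in> carrier_mat d d" "B \<in> carrier_mat d d"
  shows "mat_trace (A * B) = mat_trace (B * A)"
proof -
  have *: "mat_trace (A * B) = (\<Sum>i<d. \<Sum>j<d. A $$ (i, j) * B $$ (j, i))"
    if "A \<in> carrier_mat d d" "B \<in> carrier_mat d d" for A B :: "'a mat"
    using that by (auto simp: mat_trace_def scalar_prod_def atLeast0LessThan intro!: sum.cong)
  show ?thesis
    unfolding *[OF assms] *[OF assms(2,1)] by (subst sum.swap) (simp add: mult.commute)
qed

text \<open>Membership in the group of units comes for free: the value at the inverse element is the
  inverse matrix. Conversely, a homomorphism of groups preserves the identity.\<close>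

lemma is_representation_iff:
  assumes "group G"
  shows "is_representation G d (\<rho> :: 'g \<Rightarrow> 'f::field mat) \<longleftrightarrow>
    (\<forall>g\<in>carrier G. \<rho> g \<in> carrier_mat d d) \<and> \<rho> \<one>\<^bsub>G\<^esub> = 1\<^sub>m d \<and>
    (\<forall>g\<in>carrier G. \<forall>h\<in>carrier G. \<rho> (g \<otimes>\<^bsub>G\<^esub> h) = \<rho> g * \<rho> h)" (is "?L \<longleftrightarrow> ?R")
proof -
  interpret group G by fact
  interpret M: ring "ring_mat TYPE('f) d ()" by (rule ring_mat)
  note simps = is_representation_def hom_def Pi_iff units_of_def Units_def ring_mat_simps
  show ?thesis
  proof
    assume L: ?L
    then have hom: "\<rho> \<in> hom G (units_of (ring_mat TYPE('f) d ()))"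
      by (simp add: is_representation_def)
    have "\<rho> \<one>\<^bsub>G\<^esub> = \<one>\<^bsub>units_of (ring_mat TYPE('f) d ())\<^esub>"
      by (rule hom_one[OF hom is_group M.units_group])
    then show ?R
      using L by (simp add: simps)
  next
    assume R: ?R
    have "\<rho> (inv\<^bsub>G\<^esub> g) \<in> carrier_mat d d \<and> \<rho> (inv\<^bsub>G\<^esub> g) * \<rho> g = 1\<^sub>m d \<and> \<rho> g * \<rho> (inv\<^bsub>G\<^esub> g) = 1\<^sub>m d"
      if "g \<in> carrier G" for g
      using R that by (metis inv_closed l_inv r_inv)
    with R show ?L
      by (auto simp: simps)
  qed
qed

context galois_exponents
begin

lemma to_ac_n_nonzero: "of_nat n \<noteq> (0 :: 'f alg_closure)"
  using n_nonzero by (metis to_ac_eq_0_iff to_ac_of_nat)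

lemma rep_character_power:
  fixes G :: "('g, 'm) monoid_scheme" and \<rho> :: "'g \<Rightarrow> 'f mat"
  assumes "group G" "x \<in> carrier G" "x [^]\<^bsub>G\<^esub> n = \<one>\<^bsub>G\<^esub>"
    and rep: "is_representation G d \<rho>" and r: "r \<in> set rs"
  shows "rep_character \<rho> (x [^]\<^bsub>G\<^esub> r) = rep_character \<rho> x"
proof -
  interpret group G by fact
  note rep = rep[unfolded is_representation_iff[OF \<open>group G\<close>]]
  define a where "a k i j = to_ac (\<rho> (x [^]\<^bsub>G\<^esub> k) $$ (i, j))" for k :: nat and i j :: nat
  have carr: "\<rho> (x [^]\<^bsub>G\<^esub> k) \<in> carrier_mat d d" for k :: nat
    using rep \<open>x \<in> carrier G\<close> by simp
  have a_mult: "(\<Sum>j\<in>{..<d}. a s i j * a t j k) = a (s + t) i k" if "i \<in> {..<d}" "k \<in> {..<d}" for s t i k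
  proof -
    have "\<rho> (x [^]\<^bsub>G\<^esub> (s + t)) = \<rho> (x [^]\<^bsub>G\<^esub> s) * \<rho> (x [^]\<^bsub>G\<^esub> t)"
      using rep \<open>x \<in> carrier G\<close> by (simp flip: nat_pow_mult)
    then have "a (s + t) i k = to_ac ((\<rho> (x [^]\<^bsub>G\<^esub> s) * \<rho> (x [^]\<^bsub>G\<^esub> t)) $$ (i, k))"
      by (simp add: a_def)
    also have "\<dots> = (\<Sum>j\<in>{..<d}. a s i j * a t j k)"
      using carr[of s] carr[of t] that
      by (simp add: a_def scalar_prod_def atLeast0LessThan to_ac_sum)
    finally show ?thesis ..
  qed
  have a_per: "a (s mod n) = a s" for s
  proof -
    have "x [^]\<^bsub>G\<^esub> s = x [^]\<^bsub>G\<^esub> (n * (s div n) + s mod n)"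
      by simp
    also have "\<dots> = (x [^]\<^bsub>G\<^esub> n) [^]\<^bsub>G\<^esub> (s div n) \<otimes>\<^bsub>G\<^esub> x [^]\<^bsub>G\<^esub> (s mod n)"
      using \<open>x \<in> carrier G\<close> by (simp only: nat_pow_mult nat_pow_pow)
    finally have "x [^]\<^bsub>G\<^esub> s = x [^]\<^bsub>G\<^esub> (s mod n)"
      using assms by simp
    then show ?thesis
      by (intro ext) (simp add: a_def)
  qed
  obtain m where m: "\<And>k. (\<Sum>i\<in>{..<d}. a k i i) = (\<Sum>b<n. of_nat (m b) * \<zeta> ^ (b * k))"
    using trace_cyclic_representation[of "{..<d}", OF _ n_pos to_ac_n_nonzero prim a_mult a_per]
    by auto
  have char: "to_ac (rep_character \<rho> (x [^]\<^bsub>G\<^esub> k)) = (\<Sum>b<n. of_nat (m b) * \<zeta> ^ (b * k))" for k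
    using carr[of k] m[of k] by (simp add: rep_character_def mat_trace_def a_def to_ac_sum)
  \<comment> \<open>A polynomial over the ground field whose value at \<open>\<zeta> ^ k\<close> is
    the character at the k-th power minus the character at \<open>x\<close>. It vanishes at
    \<open>\<zeta>\<close>, the case \<open>k = 1\<close>, hence at
    \<open>\<zeta> ^ r\<close>.\<close>
  define f where "f = (\<Sum>b<n. monom (of_nat (m b) :: 'f) b) - monom (rep_character \<rho> x) 0"
  have f: "poly (map_poly to_ac f) (\<zeta> ^ k) =
      to_ac (rep_character \<rho> (x [^]\<^bsub>G\<^esub> k)) - to_ac (rep_character \<rho> x)" for k
    by (simp add: f_def char to_ac_poly_hom.hom_minus to_ac_poly_hom.hom_sum poly_sum poly_monom
        mult.commute flip: power_mult)
  have "poly (map_poly to_ac f) (\<zeta> ^ r) = 0"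
    using f[of 1] \<open>x \<in> carrier G\<close> by (intro conjugate_root[OF r]) simp
  then show ?thesis
    unfolding f by simp
qed

end

lemma rep_character_conjugate:
  assumes "group G" "is_representation G d \<rho>" "g \<in> carrier G" "h \<in> carrier G"
  shows "rep_character \<rho> (h \<otimes>\<^bsub>G\<^esub> g \<otimes>\<^bsub>G\<^esub> inv\<^bsub>G\<^esub> h) = rep_character \<rho> g"
proof -
  interpret group G by fact
  note rep = assms(2)[unfolded is_representation_iff[OF \<open>group G\<close>]]
  have "rep_character \<rho> (h \<otimes>\<^bsub>G\<^esub> g \<otimes>\<^bsub>G\<^esub> inv\<^bsub>G\<^esub> h) = mat_trace (\<rho> (h \<otimes>\<^bsub>G\<^esub> g) * \<rho> (inv\<^bsub>G\<^esub> h))"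
    using rep assms by (simp add: rep_character_def)
  also have "\<dots> = mat_trace (\<rho> (inv\<^bsub>G\<^esub> h) * \<rho> (h \<otimes>\<^bsub>G\<^esub> g))"
    using rep assms by (intro mat_trace_mult_commute[where d = d]) (metis m_closed inv_closed)+
  also have "\<rho> (inv\<^bsub>G\<^esub> h) * \<rho> (h \<otimes>\<^bsub>G\<^esub> g) = \<rho> (inv\<^bsub>G\<^esub> h \<otimes>\<^bsub>G\<^esub> (h \<otimes>\<^bsub>G\<^esub> g))"
    using rep assms by simp
  also have "inv\<^bsub>G\<^esub> h \<otimes>\<^bsub>G\<^esub> (h \<otimes>\<^bsub>G\<^esub> g) = g"
    using assms by (simp flip: m_assoc)
  finally show ?thesis
    by (simp add: rep_character_def)
qed

section \<open>Representations from idempotents of the group algebra\<close>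

lemma (in group) mult_inv_cancel:
  assumes "a \<in> carrier G" "z \<in> carrier G"
  shows "inv a \<otimes> (a \<otimes> z) = z" "a \<otimes> (inv a \<otimes> z) = z"
  using assms by (simp_all flip: m_assoc)

text \<open>
  An idempotent \<open>e\<close> of the group algebra defines the multiplicative, but non-unital, map sending
  \<open>g\<close> to the matrix with entries \<open>e (h\<^sub>i\<inverse> g h\<^sub>j)\<close>.  Adding the projection complementary to the
  image of \<open>\<one>\<close> makes it unital and changes all traces by the same amount.
\<close>

lemma field_conjugate_idempotent:
  fixes G :: "('g, 'm) monoid_scheme" and e :: "'g \<Rightarrow> 'f::field"
  assumes "group G" "finite (carrier G)"
    and idem: "\<And>w. w \<in> carrier G \<Longrightarrow> (\<Sum>u\<in>carrier G. e u * e (inv\<^bsub>G\<^esub> u \<otimes>\<^bsub>G\<^esub> w)) = e w"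
    and xy: "x \<in> carrier G" "y \<in> carrier G" "field_conjugate TYPE('f) G x y"
  shows "(\<Sum>h\<in>carrier G. e (inv\<^bsub>G\<^esub> h \<otimes>\<^bsub>G\<^esub> x \<otimes>\<^bsub>G\<^esub> h)) = (\<Sum>h\<in>carrier G. e (inv\<^bsub>G\<^esub> h \<otimes>\<^bsub>G\<^esub> y \<otimes>\<^bsub>G\<^esub> h))"
proof -
  interpret group G by fact
  define N where "N = card (carrier G)"
  obtain h where h: "bij_betw h {..<N} (carrier G)"
    using ex_bij_betw_nat_finite[OF \<open>finite (carrier G)\<close>] by (auto simp: N_def atLeast0LessThan)
  have hG: "h i \<in> carrier G" if "i < N" for i
    using h that by (auto simp: bij_betw_def)
  define \<sigma> where "\<sigma> g = mat N N (\<lambda>(i, j). e (inv\<^bsub>G\<^esub> h i \<otimes>\<^bsub>G\<^esub> g \<otimes>\<^bsub>G\<^esub> h j))" for g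
  have \<sigma>_carr: "\<sigma> g \<in> carrier_mat N N" for g
    by (simp add: \<sigma>_def)
  have \<sigma>_mult: "\<sigma> (g \<otimes>\<^bsub>G\<^esub> g') = \<sigma> g * \<sigma> g'" if g: "g \<in> carrier G" "g' \<in> carrier G" for g g'
  proof (rule eq_matI)
    fix i j assume "i < dim_row (\<sigma> g * \<sigma> g')" "j < dim_col (\<sigma> g * \<sigma> g')"
    then have ij: "i < N" "j < N"
      by (auto simp: \<sigma>_def)
    let ?w = "inv\<^bsub>G\<^esub> h i \<otimes>\<^bsub>G\<^esub> (g \<otimes>\<^bsub>G\<^esub> g') \<otimes>\<^bsub>G\<^esub> h j"
    define a where "a = inv\<^bsub>G\<^esub> h i \<otimes>\<^bsub>G\<^esub> g"
    have a: "a \<in> carrier G"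
      using g hG[OF ij(1)] by (simp add: a_def)
    have bij: "bij_betw (\<lambda>u. a \<otimes>\<^bsub>G\<^esub> u) (carrier G) (carrier G)"
      using a by (intro bij_betw_byWitness[where f' = "\<lambda>u. inv\<^bsub>G\<^esub> a \<otimes>\<^bsub>G\<^esub> u"])
        (auto simp: mult_inv_cancel)
    have "(\<sigma> g * \<sigma> g') $$ (i, j) =
        (\<Sum>k<N. e (a \<otimes>\<^bsub>G\<^esub> h k) * e (inv\<^bsub>G\<^esub> h k \<otimes>\<^bsub>G\<^esub> g' \<otimes>\<^bsub>G\<^esub> h j))"
      using ij by (simp add: a_def \<sigma>_def scalar_prod_def atLeast0LessThan)
    also have "\<dots> = (\<Sum>u\<in>carrier G. e (a \<otimes>\<^bsub>G\<^esub> u) * e (inv\<^bsub>G\<^esub> u \<otimes>\<^bsub>G\<^esub> g' \<otimes>\<^bsub>G\<^esub> h j))"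
      by (rule sum.reindex_bij_betw[OF h])
    \<comment> \<open>Inserting \<open>a\<close> and its inverse prepares the translation of
      \<open>u\<close> by \<open>a\<close>; the sum then becomes the convolution of \<open>e\<close>
      with itself at \<open>?w\<close>.\<close>
    also have "\<dots> = (\<Sum>u\<in>carrier G. e (a \<otimes>\<^bsub>G\<^esub> u) *
        e (inv\<^bsub>G\<^esub> (a \<otimes>\<^bsub>G\<^esub> u) \<otimes>\<^bsub>G\<^esub> ?w))"
    proof (intro sum.cong refl arg_cong2[where f = "(*)"] arg_cong[where f = e])
      fix u assume u: "u \<in> carrier G"
      have "?w = a \<otimes>\<^bsub>G\<^esub> (g' \<otimes>\<^bsub>G\<^esub> h j)"
        using g hG ij by (simp add: a_def m_assoc)
      moreover have "inv\<^bsub>G\<^esub> (a \<otimes>\<^bsub>G\<^esub> u) \<otimes>\<^bsub>G\<^esub> (a \<otimes>\<^bsub>G\<^esub> (g' \<otimes>\<^bsub>G\<^esub> h j)) = inv\<^bsub>G\<^esub> u \<otimes>\<^bsub>G\<^esub> (g' \<otimes>\<^bsub>G\<^esub> h j)"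
        using a u g hG[OF ij(2)] by (simp add: inv_mult_group m_assoc mult_inv_cancel)
      ultimately show "inv\<^bsub>G\<^esub> u \<otimes>\<^bsub>G\<^esub> g' \<otimes>\<^bsub>G\<^esub> h j = inv\<^bsub>G\<^esub> (a \<otimes>\<^bsub>G\<^esub> u) \<otimes>\<^bsub>G\<^esub> ?w"
        using u g hG[OF ij(2)] by (simp add: m_assoc)
    qed
    also have "\<dots> = (\<Sum>u\<in>carrier G. e u * e (inv\<^bsub>G\<^esub> u \<otimes>\<^bsub>G\<^esub> ?w))"
      by (rule sum.reindex_bij_betw[OF bij])
    also have "\<dots> = e ?w"
      using g hG ij by (intro idem) auto
    finally show "\<sigma> (g \<otimes>\<^bsub>G\<^esub> g') $$ (i, j) = (\<sigma> g * \<sigma> g') $$ (i, j)"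
      using ij by (simp add: \<sigma>_def)
  qed (auto simp: \<sigma>_def)
  define Q where "Q = 1\<^sub>m N - \<sigma> \<one>\<^bsub>G\<^esub>"
  have Q: "Q \<in> carrier_mat N N"
    by (simp add: Q_def minus_carrier_mat \<sigma>_carr)
  have \<sigma>Q: "\<sigma> g * Q = 0\<^sub>m N N" "Q * \<sigma> g = 0\<^sub>m N N" if "g \<in> carrier G" for g
    using that \<sigma>_carr[of g] \<sigma>_carr[of "\<one>\<^bsub>G\<^esub>"] \<sigma>_mult[of g "\<one>\<^bsub>G\<^esub>"] \<sigma>_mult[of "\<one>\<^bsub>G\<^esub>" g]
    by (auto simp: Q_def mult_minus_distrib_mat[OF \<sigma>_carr one_carrier_mat \<sigma>_carr]
        minus_mult_distrib_mat[OF one_carrier_mat \<sigma>_carr \<sigma>_carr])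
  have QQ: "Q * Q = Q"
  proof -
    have "(1\<^sub>m N - \<sigma> \<one>\<^bsub>G\<^esub>) * Q = 1\<^sub>m N * Q - \<sigma> \<one>\<^bsub>G\<^esub> * Q"
      by (rule minus_mult_distrib_mat[OF one_carrier_mat \<sigma>_carr Q])
    also have "\<sigma> \<one>\<^bsub>G\<^esub> * Q = 0\<^sub>m N N"
      by (rule \<sigma>Q) simp
    also have "1\<^sub>m N * Q - 0\<^sub>m N N = Q"
      using Q by (intro eq_matI) auto
    finally show ?thesis
      by (simp flip: Q_def)
  qed
  define \<rho> where "\<rho> g = \<sigma> g + Q" for g
  have \<rho>_carr: "\<rho> g \<in> carrier_mat N N" for g
    using Q \<sigma>_carr by (simp add: \<rho>_def)
  have \<rho>_mult: "\<rho> (g \<otimes>\<^bsub>G\<^esub> g') = \<rho> g * \<rho> g'" if "g \<in> carrier G" "g' \<in> carrier G" for g g'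
  proof -
    have 1: "(\<sigma> g + Q) * (\<sigma> g' + Q) = \<sigma> g * (\<sigma> g' + Q) + Q * (\<sigma> g' + Q)"
      by (rule add_mult_distrib_mat[OF \<sigma>_carr Q \<rho>_carr[unfolded \<rho>_def]])
    have 2: "\<sigma> g * (\<sigma> g' + Q) = \<sigma> g * \<sigma> g' + \<sigma> g * Q"
      by (rule mult_add_distrib_mat[OF \<sigma>_carr \<sigma>_carr Q])
    have 3: "Q * (\<sigma> g' + Q) = Q * \<sigma> g' + Q * Q"
      by (rule mult_add_distrib_mat[OF Q \<sigma>_carr Q])
    show ?thesis
      unfolding \<rho>_def 1 2 3 \<sigma>Q[OF that(1)] \<sigma>Q[OF that(2)] QQ \<sigma>_mult[OF that]
        left_add_zero_mat[OF Q] by (subst right_add_zero_mat) (auto intro: mult_carrier_mat \<sigma>_carr)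
  qed
  have "\<rho> \<one>\<^bsub>G\<^esub> = 1\<^sub>m N"
    using \<sigma>_carr[of "\<one>\<^bsub>G\<^esub>"] by (intro eq_matI) (auto simp: \<rho>_def Q_def)
  then have "is_representation G N \<rho>"
    using \<rho>_carr \<rho>_mult by (simp add: is_representation_iff[OF \<open>group G\<close>])
  then have eq: "rep_character \<rho> x = rep_character \<rho> y"
    using xy by (auto simp: field_conjugate_def)
  have trace: "rep_character \<rho> g =
      (\<Sum>u\<in>carrier G. e (inv\<^bsub>G\<^esub> u \<otimes>\<^bsub>G\<^esub> g \<otimes>\<^bsub>G\<^esub> u)) + (\<Sum>i<N. Q $$ (i, i))" for g
  proof -
    have "rep_character \<rho> g = (\<Sum>i<N. e (inv\<^bsub>G\<^esub> h i \<otimes>\<^bsub>G\<^esub> g \<otimes>\<^bsub>G\<^esub> h i)) + (\<Sum>i<N. Q $$ (i, i))"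
      using Q \<sigma>_carr[of g]
      by (simp add: rep_character_def mat_trace_def \<rho>_def \<sigma>_def flip: sum.distrib)
    also have "(\<Sum>i<N. e (inv\<^bsub>G\<^esub> h i \<otimes>\<^bsub>G\<^esub> g \<otimes>\<^bsub>G\<^esub> h i)) = (\<Sum>u\<in>carrier G. e (inv\<^bsub>G\<^esub> u \<otimes>\<^bsub>G\<^esub> g \<otimes>\<^bsub>G\<^esub> u))"
      by (rule sum.reindex_bij_betw[OF h])
    finally show ?thesis .
  qed
  show ?thesis
    using eq unfolding trace by simp
qed

text \<open>The coefficient function of the group algebra element that is the sum of
  \<open>c k\<close> times the k-th power of \<open>x\<close>.\<close>

definition on_powers :: "('g, 'm) monoid_scheme \<Rightarrow> 'g \<Rightarrow> nat \<Rightarrow> (nat \<Rightarrow> 'a::comm_monoid_add) \<Rightarrow> 'g \<Rightarrow> 'a" where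
  "on_powers G x n c g = (\<Sum>k<n. if g = x [^]\<^bsub>G\<^esub> k then c k else 0)"

lemma sum_on_powers_mult:
  fixes c :: "nat \<Rightarrow> 'a::comm_semiring_0"
  assumes "group G" "finite (carrier G)" "x \<in> carrier G"
  shows "(\<Sum>u\<in>carrier G. on_powers G x n c u * F u) = (\<Sum>k<n. c k * F (x [^]\<^bsub>G\<^esub> k))"
proof -
  interpret group G by fact
  have "(\<Sum>u\<in>carrier G. on_powers G x n c u * F u) =
      (\<Sum>u\<in>carrier G. \<Sum>k<n. if u = x [^]\<^bsub>G\<^esub> k then c k * F u else 0)"
    by (simp add: on_powers_def sum_distrib_right if_distrib[of "\<lambda>a. a * _"] cong: if_cong)
  also have "\<dots> = (\<Sum>k<n. \<Sum>u\<in>carrier G. if u = x [^]\<^bsub>G\<^esub> k then c k * F u else 0)"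
    by (rule sum.swap)
  also have "\<dots> = (\<Sum>k<n. c k * F (x [^]\<^bsub>G\<^esub> k))"
    using assms by (simp add: sum.delta)
  finally show ?thesis .
qed

section \<open>The cyclic subgroup generated by \<open>x\<close>\<close>

locale element_of_finite_order = group G for G :: "('g, 'm) monoid_scheme" (structure) +
  fixes x :: 'g and n :: nat
  assumes finite_carrier: "finite (carrier G)" and x_closed: "x \<in> carrier G" and ord_x: "ord x = n"
begin

lemma pow_n: "x [^] n = \<one>"
  using x_closed ord_x by (metis pow_ord_eq_1)

lemma ord_gt_0: "n > 0"
  using ord_ge_1[OF finite_carrier x_closed] ord_x by simp

lemma pow_mod: "x [^] (k mod n) = x [^] k"
proof -
  have "x [^] k = x [^] (n * (k div n) + k mod n)"
    by simp
  also have "\<dots> = (x [^] n) [^] (k div n) \<otimes> x [^] (k mod n)"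
    using x_closed by (simp only: nat_pow_mult nat_pow_pow)
  finally show ?thesis
    using x_closed by (simp add: pow_n)
qed

lemma pow_inj: "i < n \<Longrightarrow> j < n \<Longrightarrow> x [^] i = x [^] j \<longleftrightarrow> i = j"
  using inj_on_eq_iff[OF ord_inj[OF x_closed], of i j] ord_x by simp

lemma on_powers_pow: "on_powers G x n c (x [^] m) = c (m mod n)"
proof -
  have "on_powers G x n c (x [^] m) = (\<Sum>k<n. if m mod n = k then c k else 0)"
    unfolding on_powers_def pow_mod[of m, symmetric] using pow_inj ord_gt_0
    by (intro sum.cong) auto
  then show ?thesis
    using ord_gt_0 by simp
qed

text \<open>Convolution over the group reduces to cyclic convolution of exponents, with
  \<open>n - k\<close> in the role of -k. Off the cyclic subgroup both sides vanish, because
  translating by a power of \<open>x\<close> never leads back into it.\<close>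

lemma on_powers_idempotent:
  fixes c :: "nat \<Rightarrow> 'a::comm_semiring_0"
  assumes conv: "\<And>m. m < n \<Longrightarrow> (\<Sum>k<n. c k * c ((m + (n - k)) mod n)) = c m"
    and w: "w \<in> carrier G"
  shows "(\<Sum>u\<in>carrier G. on_powers G x n c u * on_powers G x n c (inv u \<otimes> w)) = on_powers G x n c w"
proof -
  have *: "(\<Sum>u\<in>carrier G. on_powers G x n c u * on_powers G x n c (inv u \<otimes> w)) =
      (\<Sum>k<n. c k * on_powers G x n c (inv (x [^] k) \<otimes> w))"
    by (rule sum_on_powers_mult[OF is_group finite_carrier x_closed])
  show ?thesis
  proof (cases "\<exists>m<n. w = x [^] m")
    case True
    then obtain m where m: "m < n" "w = x [^] m"
      by blast
    have "inv (x [^] k) \<otimes> w = x [^] (m + (n - k))" if "k < n" for k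
    proof -
      have "x [^] k \<otimes> x [^] (m + (n - k)) = x [^] (m + n)"
        using x_closed that by (simp add: nat_pow_mult add.commute)
      also have "\<dots> = w"
        using x_closed m by (simp add: pow_n flip: nat_pow_mult)
      finally show ?thesis
        using x_closed m by (metis inv_solve_left nat_pow_closed)
    qed
    then have "(\<Sum>k<n. c k * on_powers G x n c (inv (x [^] k) \<otimes> w)) =
        (\<Sum>k<n. c k * c ((m + (n - k)) mod n))"
      by (simp add: on_powers_pow)
    with conv[OF m(1)] m show ?thesis
      unfolding * by (simp add: on_powers_pow)
  next
    case False
    have "on_powers G x n c (inv (x [^] k) \<otimes> w) = 0" for k :: nat
    proof -
      have "inv (x [^] k) \<otimes> w \<noteq> x [^] j" for j :: nat
      proof
        assume "inv (x [^] k) \<otimes> w = x [^] j"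
        moreover have "w = x [^] k \<otimes> (inv (x [^] k) \<otimes> w)"
          using x_closed w by (intro mult_inv_cancel(2)[symmetric]) auto
        ultimately have "w = x [^] k \<otimes> x [^] j"
          by simp
        then have "w = x [^] ((k + j) mod n)"
          using x_closed by (simp add: nat_pow_mult pow_mod)
        with False ord_gt_0 show False
          by (metis mod_less_divisor)
      qed
      then show ?thesis
        by (simp add: on_powers_def)
    qed
    moreover have "on_powers G x n c w = 0"
      unfolding on_powers_def using False by (intro sum.neutral) auto
    ultimately show ?thesis
      unfolding * by simp
  qed
qed

lemma conj_pow:
  assumes "h \<in> carrier G" "g \<in> carrier G"
  shows "inv h \<otimes> g [^] (k::nat) \<otimes> h = (inv h \<otimes> g \<otimes> h) [^] k"
proof (induction k)
  case (Suc k)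
  then have "(inv h \<otimes> g \<otimes> h) [^] Suc k = inv h \<otimes> g [^] k \<otimes> h \<otimes> (inv h \<otimes> (g \<otimes> h))"
    using assms by (simp add: m_assoc)
  then show ?case
    using assms by (simp add: m_assoc mult_inv_cancel)
qed (use assms in simp)

text \<open>Conjugations composed in sequence multiply the exponents, so the set is closed under
  products; finiteness then yields inverses as powers. Writing \<open>1 mod n\<close> covers
  \<open>n = 1\<close>, where the only residue is \<open>0\<close>. Lagrange's theorem will be
  applied to this subgroup.\<close>

lemma stabilizer_subgroup:
  assumes mult: "\<And>s t. s \<in> S \<Longrightarrow> t \<in> S \<Longrightarrow> (s * t) mod n \<in> S" and one: "1 mod n \<in> S"
  shows "subgroup {h \<in> carrier G. \<exists>t\<in>S. inv h \<otimes> x \<otimes> h = x [^] t} G" (is "subgroup ?M G")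
proof -
  have M_one: "\<one> \<in> ?M"
    using one x_closed pow_mod[of 1] by (simp del: One_nat_def) (metis nat_pow_eone)
  have M_mult: "g \<otimes> h \<in> ?M" if gh: "g \<in> ?M" "h \<in> ?M" for g h
  proof -
    obtain s where s: "s \<in> S" "inv g \<otimes> x \<otimes> g = x [^] s"
      using gh(1) by auto
    obtain t where t: "t \<in> S" "inv h \<otimes> x \<otimes> h = x [^] t"
      using gh(2) by auto
    have gh': "g \<in> carrier G" "h \<in> carrier G"
      using gh by auto
    have "inv (g \<otimes> h) \<otimes> x \<otimes> (g \<otimes> h) = inv h \<otimes> (inv g \<otimes> x \<otimes> g) \<otimes> h"
      using gh' x_closed by (simp add: inv_mult_group m_assoc)
    also have "\<dots> = (x [^] t) [^] s"
      using gh' x_closed by (simp add: s t conj_pow)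
    also have "\<dots> = x [^] ((t * s) mod n)"
      using x_closed by (simp add: nat_pow_pow pow_mod)
    finally show ?thesis
      using gh' mult[OF t(1) s(1)] by auto
  qed
  show ?thesis
  proof (rule subgroupI)
    show "?M \<noteq> {}"
      using M_one by blast
    show "inv g \<in> ?M" if g: "g \<in> ?M" for g
    proof -
      have g': "g \<in> carrier G"
        using g by simp
      have "g [^] (k :: nat) \<in> ?M" for k
        by (induction k) (use M_one M_mult g in \<open>simp_all only: nat_pow_0 nat_pow_Suc\<close>)
      moreover have "inv g = g [^] (ord g - 1)"
      proof (rule inv_equality)
        have "g [^] (ord g - 1) \<otimes> g = g [^] ord g"
          using ord_ge_1[OF finite_carrier g']
          by (metis Suc_diff_1 less_eq_Suc_le One_nat_def nat_pow_Suc)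
        then show "g [^] (ord g - 1) \<otimes> g = \<one>"
          using g' by simp
      qed (use g' in auto)
      ultimately show ?thesis
        by simp
    qed
  qed (use M_mult in auto)
qed

end

section \<open>Galois stable idempotents\<close>

text \<open>Multiplication by a unit modulo \<open>n\<close> is injective, and an injective self-map
  of a finite set is a permutation.\<close>

lemma sum_reindex_mult_mod:
  fixes f :: "nat \<Rightarrow> 'a::comm_monoid_add"
  assumes "coprime u n" "S \<subseteq> {..<n}" "\<And>s. s \<in> S \<Longrightarrow> (s * u) mod n \<in> S"
  shows "(\<Sum>s\<in>S. f ((s * u) mod n)) = (\<Sum>s\<in>S. f s)"
proof -
  have fin: "finite S"
    using assms(2) by (rule finite_subset) simp
  have inj: "inj_on (\<lambda>s. (s * u) mod n) S"
  proof (rule inj_onI)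
    fix s t assume st: "s \<in> S" "t \<in> S" "(s * u) mod n = (t * u) mod n"
    then have "[s * u = t * u] (mod n)"
      by (simp add: cong_def)
    then have "[s = t] (mod n)"
      using assms(1) by (simp add: cong_mult_rcancel_nat)
    then show "s = t"
      using st assms(2) by (metis cong_def lessThan_iff mod_less subsetD)
  qed
  have "(\<lambda>s. (s * u) mod n) ` S = S"
    using assms(3) by (intro endo_inj_surj[OF fin _ inj]) auto
  then show ?thesis
    using sum.reindex[OF inj, of f] by (simp add: o_def)
qed

context galois_exponents
begin

lemma zeta_power_mod: "\<zeta> ^ (b * (k mod n)) = \<zeta> ^ (b * k)" "\<zeta> ^ ((b mod n) * k) = \<zeta> ^ (b * k)"
  by (simp_all add: primitive_root_pow_eq_iff[OF prim n_pos] mod_mult_right_eq mod_mult_left_eq)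

lemma zeta_nonzero: "\<zeta> \<noteq> 0"
  using prim n_pos by (auto simp: primitive_root_def power_0_left)

text \<open>Coefficients of the sum, over \<open>b\<close> in \<open>B\<close>, of the primitive
  idempotents of the group algebra of a cyclic group of order \<open>n\<close>.\<close>

definition idem_coeff :: "nat set \<Rightarrow> nat \<Rightarrow> 'f alg_closure" where
  "idem_coeff B k = (\<Sum>b\<in>B. \<zeta> ^ (b * k)) / of_nat n"

text \<open>Orthogonality of the characters of the cyclic group kills the products with
  \<open>b\<close> different from \<open>b'\<close>, and each diagonal term reproduces
  itself.\<close>

lemma idem_coeff_convolution:
  assumes B: "B \<subseteq> {..<n}"
  shows "(\<Sum>k<n. idem_coeff B k * idem_coeff B ((m + (n - k)) mod n)) = idem_coeff B m"
proof -
  let ?N = "of_nat n :: 'f alg_closure"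
  have fin: "finite B"
    using B by (rule finite_subset) simp
  have neg: "\<zeta> ^ (b * (n - k)) = inverse \<zeta> ^ (b * k)" if "k < n" for b k
  proof -
    have "b * (n - k) + b * k = n * b"
      using that by (simp flip: distrib_left)
    then have "\<zeta> ^ (b * (n - k)) * \<zeta> ^ (b * k) = (\<zeta> ^ n) ^ b"
      by (simp only: flip: power_add power_mult)
    also have "\<dots> = 1"
      using prim by (simp add: primitive_root_def)
    finally have "\<zeta> ^ (b * (n - k)) * \<zeta> ^ (b * k) = 1" .
    then show ?thesis
      using zeta_nonzero by (simp add: power_inverse field_simps)
  qed
  have shift: "\<zeta> ^ (b * ((m + (n - k)) mod n)) = \<zeta> ^ (b * m) * inverse \<zeta> ^ (b * k)" if "k < n" for b k
    by (simp only: zeta_power_mod distrib_left power_add neg[OF that])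
  have "idem_coeff B k * idem_coeff B ((m + (n - k)) mod n) =
      (\<Sum>b\<in>B. \<Sum>b'\<in>B. \<zeta> ^ (b' * m) * (\<zeta> ^ (k * b) * inverse \<zeta> ^ (k * b'))) / (?N * ?N)"
    if "k < n" for k
    unfolding idem_coeff_def shift[OF that] times_divide_times_eq sum_product
    by (simp only: mult_ac)
  then have "(\<Sum>k<n. idem_coeff B k * idem_coeff B ((m + (n - k)) mod n)) =
      (\<Sum>k<n. \<Sum>b\<in>B. \<Sum>b'\<in>B. \<zeta> ^ (b' * m) * (\<zeta> ^ (k * b) * inverse \<zeta> ^ (k * b'))) / (?N * ?N)"
    by (simp add: sum_divide_distrib del: add_diff_assoc)
  also have "(\<Sum>k<n. \<Sum>b\<in>B. \<Sum>b'\<in>B. \<zeta> ^ (b' * m) * (\<zeta> ^ (k * b) * inverse \<zeta> ^ (k * b'))) =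
      (\<Sum>b\<in>B. \<Sum>b'\<in>B. \<Sum>k<n. \<zeta> ^ (b' * m) * (\<zeta> ^ (k * b) * inverse \<zeta> ^ (k * b')))"
    by (rule trans[OF sum.swap]) (rule sum.cong[OF refl], rule sum.swap)
  also have "\<dots> = (\<Sum>b\<in>B. \<Sum>b'\<in>B. \<zeta> ^ (b' * m) * (\<Sum>k<n. \<zeta> ^ (k * b) * inverse \<zeta> ^ (k * b')))"
    by (simp only: sum_distrib_left)
  also have "\<dots> = (\<Sum>b\<in>B. \<Sum>b'\<in>B. if b = b' then \<zeta> ^ (b' * m) * ?N else 0)"
    unfolding primitive_root_orthogonality[OF prim n_pos]
    using B by (intro sum.cong refl) (auto simp: subset_iff)
  also have "\<dots> = (\<Sum>b\<in>B. \<zeta> ^ (b * m)) * ?N"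
    using fin by (simp add: sum_distrib_right)
  finally show ?thesis
    using to_ac_n_nonzero by (simp add: idem_coeff_def)
qed

text \<open>Passing to the conjugate \<open>\<zeta> ^ u\<close> only permutes the summands, because
  \<open>B\<close> is stable. The sum is therefore the same at every conjugate, and
  \<open>descent\<close> applies.\<close>

lemma idem_coeff_in_range:
  assumes B: "B \<subseteq> {..<n}" and stable: "\<And>b u. b \<in> B \<Longrightarrow> u \<in> set rs \<Longrightarrow> (b * u) mod n \<in> B"
  shows "idem_coeff B k \<in> range to_ac"
proof -
  define f where "f = (\<Sum>b\<in>B. monom (1 :: 'f) (b * k))"
  have "(\<Sum>b\<in>B. \<zeta> ^ (b * k)) \<in> range to_ac"
  proof (rule descent)
    fix u assume u: "u \<in> set rs"
    have "poly (map_poly to_ac f) (\<zeta> ^ u) = (\<Sum>b\<in>B. \<zeta> ^ (((b * u) mod n) * k))"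
      unfolding zeta_power_mod
      by (simp add: f_def to_ac_poly_hom.hom_sum poly_sum poly_monom mult_ac flip: power_mult)
    also have "\<dots> = (\<Sum>b\<in>B. \<zeta> ^ (b * k))"
      using stable u by (intro sum_reindex_mult_mod[OF coprime_exponent[OF u] B])
    finally show "poly (map_poly to_ac f) (\<zeta> ^ u) = (\<Sum>b\<in>B. \<zeta> ^ (b * k))" .
  qed
  then obtain v where "(\<Sum>b\<in>B. \<zeta> ^ (b * k)) = to_ac v"
    by blast
  then have "idem_coeff B k = to_ac (v / of_nat n)"
    by (simp add: idem_coeff_def)
  then show ?thesis
    by blast
qed

end

section \<open>Sums over conjugates and the comparison of classes\<close>

locale galois_exponents_in_group =
  galois_exponents \<zeta> n rs + element_of_finite_order G x n
  for \<zeta> :: "'f::field alg_closure" and n rs and G :: "('g, 'm) monoid_scheme" (structure) and x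
begin

definition residues :: "nat set" where
  "residues = (\<lambda>r. r mod n) ` set rs"

lemma residues_subset: "residues \<subseteq> {..<n}"
  using n_pos by (auto simp: residues_def)

lemma residues_mult: "s \<in> residues \<Longrightarrow> t \<in> residues \<Longrightarrow> (s * t) mod n \<in> residues"
  using closed by (fastforce simp: residues_def mod_mult_eq)

text \<open>For idempotent coefficients in the ground field this is, up to an additive constant, the
  character of the representation they generate.\<close>

definition conj_sum :: "(nat \<Rightarrow> 'a) \<Rightarrow> 'g \<Rightarrow> 'a::comm_monoid_add" where
  "conj_sum c g = (\<Sum>h\<in>carrier G. on_powers G x n c (inv h \<otimes> g \<otimes> h))"

lemma conj_sum_linear:
  fixes c :: "'i \<Rightarrow> nat \<Rightarrow> 'a::comm_ring_1"
  shows "conj_sum (\<lambda>k. \<Sum>b\<in>B. a b * c b k) g = (\<Sum>b\<in>B. a b * conj_sum (c b) g)"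
proof -
  have "on_powers G x n (\<lambda>k. \<Sum>b\<in>B. a b * c b k) u = (\<Sum>b\<in>B. a b * on_powers G x n (c b) u)" for u
  proof -
    have "on_powers G x n (\<lambda>k. \<Sum>b\<in>B. a b * c b k) u =
        (\<Sum>k<n. \<Sum>b\<in>B. a b * (if u = x [^] k then c b k else 0))"
      unfolding on_powers_def by (intro sum.cong) auto
    also have "\<dots> = (\<Sum>b\<in>B. a b * on_powers G x n (c b) u)"
      by (subst sum.swap) (simp add: on_powers_def sum_distrib_left)
    finally show ?thesis .
  qed
  then have "conj_sum (\<lambda>k. \<Sum>b\<in>B. a b * c b k) g =
      (\<Sum>h\<in>carrier G. \<Sum>b\<in>B. a b * on_powers G x n (c b) (inv h \<otimes> g \<otimes> h))"
    by (simp add: conj_sum_def)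
  also have "\<dots> = (\<Sum>b\<in>B. a b * conj_sum (c b) g)"
    by (subst sum.swap) (simp add: conj_sum_def sum_distrib_left)
  finally show ?thesis .
qed

text \<open>The coefficients come from the ground field, and since \<open>to_ac\<close> is injective
  the idempotent identity descends with them. The resulting representation over the ground field is
  one on which \<open>x\<close> and \<open>y\<close> must agree.\<close>

lemma conj_sum_idem_coeff:
  assumes "y \<in> carrier G" "field_conjugate TYPE('f) G x y"
    and B: "B \<subseteq> {..<n}" and stable: "\<And>b u. b \<in> B \<Longrightarrow> u \<in> set rs \<Longrightarrow> (b * u) mod n \<in> B"
  shows "conj_sum (idem_coeff B) x = conj_sum (idem_coeff B) y"
proof -
  define c where "c k = of_ac (idem_coeff B k)" for k
  have c: "to_ac (c k) = idem_coeff B k" for k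
    unfolding c_def by (intro to_ac_of_ac idem_coeff_in_range[OF B stable])
  have e: "to_ac (on_powers G x n c g) = on_powers G x n (idem_coeff B) g" for g
    unfolding on_powers_def to_ac_sum by (intro sum.cong) (auto simp: c)
  have "(\<Sum>k<n. c k * c ((m + (n - k)) mod n)) = c m" for m
    using idem_coeff_convolution[OF B, of m] by (simp flip: c to_ac_mult to_ac_sum)
  then have "(\<Sum>u\<in>carrier G. on_powers G x n c u * on_powers G x n c (inv u \<otimes> w)) =
      on_powers G x n c w" if "w \<in> carrier G" for w
    using that by (intro on_powers_idempotent)
  then have "conj_sum c x = conj_sum c y"
    unfolding conj_sum_def using assms x_closed finite_carrier
    by (intro field_conjugate_idempotent[OF is_group]) auto
  then have "to_ac (conj_sum c x) = to_ac (conj_sum c y)"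
    by simp
  then show ?thesis
    by (simp add: conj_sum_def to_ac_sum e)
qed

text \<open>
  The weights \<open>\<gamma> b = (\<Sum>t\<in>residues. \<zeta>\<^bsup>-bt\<^esup>)\<close> are constant on Galois orbits, so their
  level sets are Galois stable; by Fourier inversion the weighted sum of the characters
  \<open>k \<mapsto> \<zeta>\<^bsup>bk\<^esup>\<close> is \<open>n\<close> times the indicator function of the residues.
\<close>

lemma conj_sum_residues:
  assumes "y \<in> carrier G" "field_conjugate TYPE('f) G x y"
  defines "ind \<equiv> \<lambda>k. if k \<in> residues then of_nat n else (0 :: 'f alg_closure)"
  shows "conj_sum ind x = conj_sum ind y"
proof -
  define \<gamma> where "\<gamma> b = (\<Sum>t\<in>residues. inverse \<zeta> ^ (b * t))" for b
  define \<chi> where "\<chi> b k = \<zeta> ^ (b * k)" for b k :: nat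
  have \<gamma>_stable: "\<gamma> ((b * u) mod n) = \<gamma> b" if u: "u \<in> set rs" for b u
  proof -
    have inverse_mod: "inverse \<zeta> ^ (b * (t mod n)) = inverse \<zeta> ^ (b * t)"
      "inverse \<zeta> ^ ((b mod n) * t) = inverse \<zeta> ^ (b * t)" for b t
      by (simp_all add: power_inverse zeta_power_mod)
    \<comment> \<open>The residues are permuted by multiplication with \<open>u\<close>, so
      replacing \<open>b\<close> by \<open>b * u\<close> merely reorders the sum defining
      \<open>\<gamma> b\<close>.\<close>
    have "(t * u) mod n \<in> residues" if "t \<in> residues" for t
      using residues_mult[OF that, of "u mod n"] u by (auto simp: residues_def mod_mult_right_eq)
    then have "(\<Sum>t\<in>residues. inverse \<zeta> ^ (b * ((t * u) mod n))) = \<gamma> b"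
      unfolding \<gamma>_def
      by (intro sum_reindex_mult_mod[OF coprime_exponent[OF u] residues_subset])
    then show ?thesis
      by (simp add: \<gamma>_def inverse_mod mult_ac)
  qed
  have level: "(\<Sum>b | b < n \<and> \<gamma> b = v. conj_sum (\<chi> b) x) = (\<Sum>b | b < n \<and> \<gamma> b = v. conj_sum (\<chi> b) y)" for v
  proof -
    let ?B = "{b. b < n \<and> \<gamma> b = v}"
    have idem: "idem_coeff ?B = (\<lambda>k. \<Sum>b\<in>?B. inverse (of_nat n) * \<chi> b k)"
      by (intro ext) (simp add: idem_coeff_def \<chi>_def sum_distrib_left divide_inverse mult.commute)
    have "conj_sum (idem_coeff ?B) x = conj_sum (idem_coeff ?B) y"
      using assms \<gamma>_stable n_pos by (intro conj_sum_idem_coeff) auto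
    then have "(\<Sum>b\<in>?B. inverse (of_nat n) * conj_sum (\<chi> b) x) = (\<Sum>b\<in>?B. inverse (of_nat n) * conj_sum (\<chi> b) y)"
      unfolding idem conj_sum_linear .
    then show ?thesis
      using to_ac_n_nonzero by (simp flip: sum_distrib_left)
  qed
  have ind: "conj_sum ind g = (\<Sum>v\<in>\<gamma> ` {..<n}. v * (\<Sum>b | b < n \<and> \<gamma> b = v. conj_sum (\<chi> b) g))" for g
  proof -
    have "(\<Sum>b<n. \<gamma> b * \<chi> b k) = ind k" if "k < n" for k
    proof -
      have "(\<Sum>b<n. \<gamma> b * \<chi> b k) = (\<Sum>t\<in>residues. \<Sum>b<n. \<zeta> ^ (b * k) * inverse \<zeta> ^ (b * t))"
        unfolding \<gamma>_def \<chi>_def sum_distrib_right by (subst sum.swap) (simp only: mult.commute)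
      also have "\<dots> = (\<Sum>t\<in>residues. if k = t then of_nat n else 0)"
        unfolding primitive_root_orthogonality[OF prim n_pos]
        using residues_subset that by (intro sum.cong) auto
      also have "\<dots> = ind k"
        using finite_subset[OF residues_subset] by (simp add: ind_def)
      finally show ?thesis .
    qed
    then have "conj_sum ind g = conj_sum (\<lambda>k. \<Sum>b<n. \<gamma> b * \<chi> b k) g"
      unfolding conj_sum_def on_powers_def by (intro sum.cong) auto
    also have "\<dots> = (\<Sum>b<n. \<gamma> b * conj_sum (\<chi> b) g)"
      by (rule conj_sum_linear)
    \<comment> \<open>Grouping by the value of the weight lets it be pulled out, which leaves only
      the level set sums already known to agree.\<close>
    also have "\<dots> = (\<Sum>v\<in>\<gamma> ` {..<n}. \<Sum>b | b \<in> {..<n} \<and> \<gamma> b = v. \<gamma> b * conj_sum (\<chi> b) g)"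
      by (rule sum.image_gen) simp
    also have "\<dots> = (\<Sum>v\<in>\<gamma> ` {..<n}. v * (\<Sum>b | b < n \<and> \<gamma> b = v. conj_sum (\<chi> b) g))"
      by (intro sum.cong refl) (simp add: sum_distrib_left)
    finally show ?thesis .
  qed
  show ?thesis
    unfolding ind level ..
qed

text \<open>The class sum of \<open>ind\<close> is \<open>n\<close> times a count of conjugating
  elements, read in the field. In positive characteristic a positive count could vanish there, so
  its nonvanishing at \<open>x\<close> is derived from divisibility of the group order.\<close>

lemma conjugate_of_field_conjugate:
  assumes order: "of_nat (Coset.order G) \<noteq> (0 :: 'f)"
    and y: "y \<in> carrier G" "field_conjugate TYPE('f) G x y"
  shows "\<exists>h\<in>carrier G. \<exists>r\<in>set rs. y = h \<otimes> x [^] r \<otimes> inv h"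
proof -
  define ind where "ind k = (if k \<in> residues then of_nat n else (0 :: 'f alg_closure))" for k
  let ?M = "{h \<in> carrier G. \<exists>t\<in>residues. inv h \<otimes> x \<otimes> h = x [^] t}"
  have on_ind: "on_powers G x n ind g = (if \<exists>t\<in>residues. g = x [^] t then of_nat n else 0)" for g
  proof (cases "\<exists>t\<in>residues. g = x [^] t")
    case True
    then obtain t where "t \<in> residues" "g = x [^] t"
      by blast
    moreover have "t mod n = t"
      using \<open>t \<in> residues\<close> residues_subset by auto
    ultimately show ?thesis
      using True by (simp add: on_powers_pow ind_def)
  next
    case False
    then have "on_powers G x n ind g = 0"
      unfolding on_powers_def ind_def by (intro sum.neutral) auto
    with False show ?thesis
      by simp
  qed
  have "1 mod n \<in> residues"
    using one_mem unfolding residues_def by blast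
  then have sub: "subgroup ?M G"
    by (intro stabilizer_subgroup residues_mult) auto
  \<comment> \<open>By Lagrange the count divides the group order; a divisor of a number that is
    nonzero in the field is nonzero there as well.\<close>
  have "card ?M dvd Coset.order G"
    unfolding lagrange[OF sub, symmetric] by simp
  then have "of_nat (card ?M) \<noteq> (0 :: 'f)"
    using order by (auto elim!: dvdE)
  then have M: "of_nat (card ?M) \<noteq> (0 :: 'f alg_closure)"
    by (simp only: to_ac_of_nat[symmetric] to_ac_eq_0_iff not_False_eq_True)
  have "conj_sum ind x = (\<Sum>h\<in>?M. of_nat n)"
    unfolding conj_sum_def on_ind by (subst sum.inter_filter[OF finite_carrier]) (rule refl)
  with M have "conj_sum ind x \<noteq> 0"
    using to_ac_n_nonzero by simp
  moreover have "conj_sum ind x = conj_sum ind y"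
    unfolding ind_def by (rule conj_sum_residues[OF y])
  ultimately have "conj_sum ind y \<noteq> 0"
    by simp
  then obtain h where h: "h \<in> carrier G" "on_powers G x n ind (inv h \<otimes> y \<otimes> h) \<noteq> 0"
    unfolding conj_sum_def using sum.not_neutral_contains_not_neutral by blast
  then obtain r where r: "r \<in> set rs" "inv h \<otimes> y \<otimes> h = x [^] r"
    by (auto simp: on_ind residues_def pow_mod split: if_splits)
  have "h \<otimes> x [^] r \<otimes> inv h = y"
    using h(1) y(1) by (simp add: r(2)[symmetric] m_assoc mult_inv_cancel)
  with h(1) r(1) show ?thesis
    by blast
qed

end

theorem theorem3p1p4:
  fixes G :: "('g, 'm) monoid_scheme" and x :: 'g and n :: nat and rs :: "nat list"
  assumes "group G"
    and "finite (carrier G)"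
    and "CHAR('f::field) = 0 \<or> coprime CHAR('f) (Coset.order G)"
    and "x \<in> carrier G"
    and "group.ord G x = n"
    and "cyclotomic_sequence TYPE('f) n rs"
  shows "field_conjugacy_class TYPE('f) G x =
           (\<Union>r\<in>set rs. conjugacy_class G (x [^]\<^bsub>G\<^esub> r))"
proof -
  interpret group G by fact
  interpret element_of_finite_order G x n
    by unfold_locales fact+
  have "Coset.order G > 0"
    using assms(2) by (simp add: order_gt_0_iff_finite)
  \<comment> \<open>The characteristic would divide the positive group order, so it is not
    \<open>0\<close>. Coprimality would then make it \<open>1\<close>, which is impossible in a
    field.\<close>
  have order: "of_nat (Coset.order G) \<noteq> (0 :: 'f)"
  proof
    assume "of_nat (Coset.order G) = (0 :: 'f)"
    then have dvd: "CHAR('f) dvd Coset.order G"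
      by (simp add: of_nat_eq_0_iff_char_dvd)
    with \<open>Coset.order G > 0\<close> have "CHAR('f) \<noteq> 0"
      by auto
    with assms(3) have "coprime CHAR('f) (Coset.order G)"
      by simp
    with dvd have "CHAR('f) = 1"
      using coprime_common_divisor by fastforce
    then show False
      by simp
  qed
  have "n dvd Coset.order G"
    using ord_dvd_group_order[OF x_closed] ord_x by simp
  with order have n: "of_nat n \<noteq> (0 :: 'f)"
    by (auto elim!: dvdE)
  obtain \<zeta> :: "'f alg_closure" where "galois_exponents \<zeta> n rs"
    using ex_galois_exponents[OF assms(6) ord_gt_0 n] by blast
  then interpret galois_exponents_in_group \<zeta> n rs G x
    by (intro galois_exponents_in_group.intro element_of_finite_order_axioms)
  show ?thesis
  proof (intro equalityI subsetI)
    fix y assume "y \<in> field_conjugacy_class TYPE('f) G x"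
    then have "\<exists>h\<in>carrier G. \<exists>r\<in>set rs. y = h \<otimes>\<^bsub>G\<^esub> x [^]\<^bsub>G\<^esub> r \<otimes>\<^bsub>G\<^esub> inv\<^bsub>G\<^esub> h"
      by (intro conjugate_of_field_conjugate[OF order]) (auto simp: field_conjugacy_class_def)
    then show "y \<in> (\<Union>r\<in>set rs. conjugacy_class G (x [^]\<^bsub>G\<^esub> r))"
      by (auto simp: conjugacy_class_def)
  next
    fix y assume "y \<in> (\<Union>r\<in>set rs. conjugacy_class G (x [^]\<^bsub>G\<^esub> r))"
    then obtain r h where r: "r \<in> set rs" and h: "h \<in> carrier G"
      and y: "y = h \<otimes>\<^bsub>G\<^esub> x [^]\<^bsub>G\<^esub> r \<otimes>\<^bsub>G\<^esub> inv\<^bsub>G\<^esub> h"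
      by (auto simp: conjugacy_class_def)
    have "rep_character \<rho> x = rep_character \<rho> y"
      if "is_representation G d \<rho>" for d and \<rho> :: "'g \<Rightarrow> 'f mat"
      unfolding y using rep_character_conjugate[OF assms(1) that _ h] x_closed
        rep_character_power[OF assms(1) x_closed pow_n that r] by simp
    then show "y \<in> field_conjugacy_class TYPE('f) G x"
      using y h x_closed by (simp add: field_conjugacy_class_def field_conjugate_def)
  qed
qed

end
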